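(* Let $c\in\mathbb{R}^n$, $A\in\mathbb{R}^{m\times n}$ with $i$-th row $a_i^T$, and $G\in\mathbb{R}^{n\times n}$. Suppose $\rho(G)<1$ and the set $P=\{x\in\mathbb{R}^n\mid Ax\le 1\}$ is bounded. For each integer $r\ge 0$ consider the optimization problem $$(\mathrm{N}_r)\quad \min_{x\in\mathbb{R}^n,\,H\in S^{n\times n}} c^Tx\ \text{ s.t. }\ H\succ0,\ \ G^THG\preceq H,\ \ \big(\forall z\in\mathbb{R}^n:\ z^THz\le 1\Rightarrow Az\le 1\big),\ \ (G^rx)^TH(G^rx)\le 1,\ \ AG^kx\le 1,\ k=0,\dots,r-1,$$ and the semidefinite program $$(\mathrm{SDP}_r)\quad \min_{x\in\mathbb{R}^n,\,Q\in S^{n\times n}} c^Tx\ \text{ s.t. }\ Q\succ0,\ \ GQG^T\preceq Q,\ \ a_i^TQa_i\le 1,\ i=1,\dots,m,\ \ \begin{pmatrix}Q & G^rx\\ (G^rx)^T & 1\end{pmatrix}\succeq0,\ \ AG^kx\le 1,\ k=0,\dots,r-1.$$ Then: (i) The optimal values of $(\mathrm{N}_r)$ and $(\mathrm{SDP}_r)$ are the same, the optimal vectors $x_r$ in the two problems are the same, and the optimal matrices $H_r$ and $Q_r$ are related via $Q_r=H_r^{-1}$. (ii) The optimal values of $(\mathrm{SDP}_r)$ provide upper bounds on the optimal value of the R-LD-LP $\min\{c^Tx : G^kx\in P,\ k=0,1,2,\dots\}$, are nonincreasing with $r$, and reach the optimal value of the R-LD-LP in a finite number of steps $\bar r$ which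 (for rational $A,G$) can be computed in time polynomial in $\sigma(A,G)$. Moreover, any optimal solution $x_r$ to $(\mathrm{SDP}_r)$ with $r\ge\bar r$ is an optimal solution to the R-LD-LP.
   Context: $\rho(G)$ is the spectral radius of $G$; $S^{n\times n}$ is the set of $n\times n$ real symmetric matrices; $\succ,\succeq$ (and $\prec,\preceq$) denote the positive (semi)definite order. $Ax\le 1$ means each entry of $Ax$ is at most $1$. When $r=0$ the constraints $AG^kx\le1$, $k=0,\dots,r-1$, are absent. R-LD-LP stands for robust to linear dynamics linear program. The size of a rational number $p/q$ ($p,q$ relatively prime integers) is $1+\lceil\log_2(|p|+1)\rceil+\lceil\log_2(|q|+1)\rceil$; the size of a rational matrix is the sum of the sizes of its entries plus the product of its dimensions; $\sigma(A,G)$ is the total size of $A$ and $G$. Complexity is in the standard Turing model. *)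

theory Defs
  imports
    "HOL-Library.Extended_Real"
    "HOL-Computational_Algebra.Polynomial"
    "Jordan_Normal_Form.Spectral_Radius"
begin

definition sym_mat :: "real mat \<Rightarrow> bool" where
  "sym_mat M \<longleftrightarrow> square_mat M \<and> M\<^sup>T = M"

definition pos_def :: "real mat \<Rightarrow> bool" where
  "pos_def M \<longleftrightarrow> sym_mat M \<and>
     (\<forall>v \<in> carrier_vec (dim_row M). v \<noteq> 0\<^sub>v (dim_row M) \<longrightarrow> v \<bullet> (M *\<^sub>v v) > 0)"

definition pos_semidef :: "real mat \<Rightarrow> bool" where
  "pos_semidef M \<longleftrightarrow> sym_mat M \<and> (\<forall>v \<in> carrier_vec (dim_row M). v \<bullet> (M *\<^sub>v v) \<ge> 0)"

definition loewner_le :: "real mat \<Rightarrow> real mat \<Rightarrow> bool"  (infix "\<preceq>\<^sub>L" 50) where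
  "M \<preceq>\<^sub>L N \<longleftrightarrow> pos_semidef (N - M)"

definition real_spectral_radius :: "real mat \<Rightarrow> real" where
  "real_spectral_radius G = spectral_radius (map_mat complex_of_real G)"

definition ones_vec :: "nat \<Rightarrow> real vec" where
  "ones_vec m = vec m (\<lambda>_. 1)"

definition polyhedron_le_one :: "real mat \<Rightarrow> real vec set" where
  "polyhedron_le_one A = {x \<in> carrier_vec (dim_col A). A *\<^sub>v x \<le> ones_vec (dim_row A)}"

text \<open>The type of vectors of arbitrary dimension carries no metric, so boundedness in the
  Euclidean norm is spelled out.\<close>

definition bounded_vecs :: "real vec set \<Rightarrow> bool" where
  "bounded_vecs X \<longleftrightarrow> (\<exists>B. \<forall>x\<in>X. sqrt (x \<bullet> x) \<le> B)"

text \<open>Minima need not be attained (for \<open>G = 0\<close> and \<open>r = 0\<close>, say, the optimal \<open>Q\<close> may exist only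
  as a singular limit), so the optimal value is an infimum in the extended reals; it is
  \<open>\<infinity>\<close> for an infeasible problem.\<close>

definition opt_value :: "('a \<Rightarrow> real) \<Rightarrow> 'a set \<Rightarrow> ereal" where
  "opt_value f F = (INF z\<in>F. ereal (f z))"

definition is_optimal :: "('a \<Rightarrow> real) \<Rightarrow> 'a set \<Rightarrow> 'a \<Rightarrow> bool" where
  "is_optimal f F z \<longleftrightarrow> is_arg_min f (\<lambda>y. y \<in> F) z"

text \<open>In all three problems the dimension \<open>n\<close> is the number of columns of \<open>A\<close>.\<close>

definition feasible_N :: "real mat \<Rightarrow> real mat \<Rightarrow> nat \<Rightarrow> (real vec \<times> real mat) set" where
  "feasible_N A G r = (let n = dim_col A; m = dim_row A in
     {(x, H). x \<in> carrier_vec n \<and> H \<in> carrier_mat n n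
        \<and> pos_def H
        \<and> G\<^sup>T * H * G \<preceq>\<^sub>L H
        \<and> (\<forall>z \<in> carrier_vec n. z \<bullet> (H *\<^sub>v z) \<le> 1 \<longrightarrow> A *\<^sub>v z \<le> ones_vec m)
        \<and> ((G ^\<^sub>m r) *\<^sub>v x) \<bullet> (H *\<^sub>v ((G ^\<^sub>m r) *\<^sub>v x)) \<le> 1
        \<and> (\<forall>k<r. (A * G ^\<^sub>m k) *\<^sub>v x \<le> ones_vec m)})"

definition bordered_mat :: "real mat \<Rightarrow> real vec \<Rightarrow> real mat" where
  "bordered_mat Q v =
     four_block_mat Q (mat_of_cols (dim_vec v) [v]) (mat_of_rows (dim_vec v) [v]) (1\<^sub>m 1)"

definition feasible_SDP :: "real mat \<Rightarrow> real mat \<Rightarrow> nat \<Rightarrow> (real vec \<times> real mat) set" where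
  "feasible_SDP A G r = (let n = dim_col A; m = dim_row A in
     {(x, Q). x \<in> carrier_vec n \<and> Q \<in> carrier_mat n n
        \<and> pos_def Q
        \<and> G * Q * G\<^sup>T \<preceq>\<^sub>L Q
        \<and> (\<forall>i<m. row A i \<bullet> (Q *\<^sub>v row A i) \<le> 1)
        \<and> pos_semidef (bordered_mat Q ((G ^\<^sub>m r) *\<^sub>v x))
        \<and> (\<forall>k<r. (A * G ^\<^sub>m k) *\<^sub>v x \<le> ones_vec m)})"

definition feasible_RLDLP :: "real mat \<Rightarrow> real mat \<Rightarrow> real vec set" where
  "feasible_RLDLP A G =
     {x \<in> carrier_vec (dim_col A). \<forall>k. (G ^\<^sub>m k) *\<^sub>v x \<in> polyhedron_le_one A}"

definition lin_obj :: "real vec \<Rightarrow> real vec \<times> real mat \<Rightarrow> real" where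
  "lin_obj c = (\<lambda>(x, M). c \<bullet> x)"

definition value_N :: "real vec \<Rightarrow> real mat \<Rightarrow> real mat \<Rightarrow> nat \<Rightarrow> ereal" where
  "value_N c A G r = opt_value (lin_obj c) (feasible_N A G r)"

definition value_SDP :: "real vec \<Rightarrow> real mat \<Rightarrow> real mat \<Rightarrow> nat \<Rightarrow> ereal" where
  "value_SDP c A G r = opt_value (lin_obj c) (feasible_SDP A G r)"

definition value_RLDLP :: "real vec \<Rightarrow> real mat \<Rightarrow> real mat \<Rightarrow> ereal" where
  "value_RLDLP c A G = opt_value (\<lambda>x. c \<bullet> x) (feasible_RLDLP A G)"

definition optimal_N :: "real vec \<Rightarrow> real mat \<Rightarrow> real mat \<Rightarrow> nat \<Rightarrow> (real vec \<times> real mat) set" where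
  "optimal_N c A G r = Collect (is_optimal (lin_obj c) (feasible_N A G r))"

definition optimal_SDP :: "real vec \<Rightarrow> real mat \<Rightarrow> real mat \<Rightarrow> nat \<Rightarrow> (real vec \<times> real mat) set" where
  "optimal_SDP c A G r = Collect (is_optimal (lin_obj c) (feasible_SDP A G r))"

definition optimal_RLDLP :: "real vec \<Rightarrow> real mat \<Rightarrow> real mat \<Rightarrow> real vec set" where
  "optimal_RLDLP c A G = Collect (is_optimal (\<lambda>x. c \<bullet> x) (feasible_RLDLP A G))"

text \<open>The dimension \<open>n\<close> is positive: otherwise the spectrum of \<open>G\<close> is empty and its maximum unspecified.\<close>

definition admissible :: "nat \<Rightarrow> nat \<Rightarrow> real mat \<Rightarrow> real mat \<Rightarrow> bool" where
  "admissible m n A G \<longleftrightarrow> n \<ge> 1 \<and> A \<in> carrier_mat m n \<and> G \<in> carrier_mat n n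
     \<and> real_spectral_radius G < 1 \<and> bounded_vecs (polyhedron_le_one A)"

definition mutually_inverse :: "real mat \<Rightarrow> real mat \<Rightarrow> bool" where
  "mutually_inverse H Q \<longleftrightarrow> inverts_mat H Q \<and> inverts_mat Q H"

text \<open>\<open>quotient_of\<close> returns numerator and (positive) denominator in lowest terms.\<close>

definition rat_size :: "rat \<Rightarrow> nat" where
  "rat_size a = (case quotient_of a of (p, q) \<Rightarrow>
     1 + nat \<lceil>log 2 (real_of_int \<bar>p\<bar> + 1)\<rceil> + nat \<lceil>log 2 (real_of_int \<bar>q\<bar> + 1)\<rceil>)"

definition mat_size :: "rat mat \<Rightarrow> nat" where
  "mat_size M =
     (\<Sum>i<dim_row M. \<Sum>j<dim_col M. rat_size (M $$ (i, j))) + dim_row M * dim_col M"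

definition data_size :: "rat mat \<Rightarrow> rat mat \<Rightarrow> nat" where
  "data_size A G = mat_size A + mat_size G"

datatype letter = Zero | One | Minus | Slash | Comma | Semicolon | Hash

text \<open>Tape symbols are natural numbers: 0 is the blank, 1 to 7 are the input and output letters,
  and a machine may use finitely many further symbols.\<close>

fun letter_code :: "letter \<Rightarrow> nat" where
  "letter_code Zero = 1"
| "letter_code One = 2"
| "letter_code Minus = 3"
| "letter_code Slash = 4"
| "letter_code Comma = 5"
| "letter_code Semicolon = 6"
| "letter_code Hash = 7"

datatype move = MoveLeft | Stay | MoveRight

text \<open>A machine has states \<open>0, \<dots>, tm_halt\<close>, where \<open>0\<close> is initial and \<open>tm_halt\<close> is the only
  halting state, and symbols \<open>0, \<dots>, tm_symbols - 1\<close>. The transition function maps a state and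
  the scanned symbols to a new state and, for each tape, a symbol to write and a head move.\<close>

record turing_machine =
  tm_tapes :: nat
  tm_halt :: nat
  tm_symbols :: nat
  tm_delta :: "nat \<Rightarrow> nat list \<Rightarrow> nat \<times> (nat \<times> move) list"

definition well_formed_tm :: "turing_machine \<Rightarrow> bool" where
  "well_formed_tm M \<longleftrightarrow> tm_tapes M \<ge> 1 \<and> tm_symbols M \<ge> 8 \<and>
     (\<forall>q < tm_halt M. \<forall>ss. length ss = tm_tapes M \<and> (\<forall>s \<in> set ss. s < tm_symbols M) \<longrightarrow>
        (case tm_delta M q ss of (q', acts) \<Rightarrow>
           q' \<le> tm_halt M \<and> length acts = tm_tapes M \<and> (\<forall>(s, d) \<in> set acts. s < tm_symbols M)))"

text \<open>A tape is infinite in both directions; it is given by its contents and the head position.\<close>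

type_synonym tape = "(int \<Rightarrow> nat) \<times> int"

fun tape_read :: "tape \<Rightarrow> nat" where
  "tape_read (f, h) = f h"

fun tape_act :: "nat \<times> move \<Rightarrow> tape \<Rightarrow> tape" where
  "tape_act (s, d) (f, h) =
     (f(h := s), (case d of MoveLeft \<Rightarrow> h - 1 | Stay \<Rightarrow> h | MoveRight \<Rightarrow> h + 1))"

type_synonym config = "nat \<times> tape list"

definition tm_step :: "turing_machine \<Rightarrow> config \<Rightarrow> config" where
  "tm_step M = (\<lambda>(q, ts). if q = tm_halt M then (q, ts)
     else (case tm_delta M q (map tape_read ts) of (q', acts) \<Rightarrow> (q', map2 tape_act acts ts)))"

definition word_on_tape :: "letter list \<Rightarrow> int \<Rightarrow> nat" where
  "word_on_tape w = (\<lambda>i. if 0 \<le> i \<and> i < int (length w) then letter_code (w ! nat i) else 0)"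

text \<open>The input is on the first tape, the output on the last one.\<close>

definition initial_config :: "turing_machine \<Rightarrow> letter list \<Rightarrow> config" where
  "initial_config M w =
     (0, (word_on_tape w, 0) # replicate (tm_tapes M - 1) (word_on_tape [], 0))"

definition computes_within :: "turing_machine \<Rightarrow> letter list \<Rightarrow> letter list \<Rightarrow> nat \<Rightarrow> bool" where
  "computes_within M w v t \<longleftrightarrow>
     (case (tm_step M ^^ t) (initial_config M w) of (q, ts) \<Rightarrow>
        q = tm_halt M \<and> fst (last ts) = word_on_tape v)"

text \<open>For admissible data the encoding below is injective and its length is linear in
  \<open>data_size\<close>.\<close>

fun encode_nat :: "nat \<Rightarrow> letter list" where
  "encode_nat k = (if k < 2 then [] else encode_nat (k div 2)) @ [if even k then Zero else One]"

definition encode_int :: "int \<Rightarrow> letter list" where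
  "encode_int k = (if k < 0 then [Minus] else []) @ encode_nat (nat \<bar>k\<bar>)"

definition encode_rat :: "rat \<Rightarrow> letter list" where
  "encode_rat a = (case quotient_of a of (p, q) \<Rightarrow> encode_int p @ [Slash] @ encode_int q)"

definition encode_row :: "rat vec \<Rightarrow> letter list" where
  "encode_row v = concat (map (\<lambda>a. encode_rat a @ [Comma]) (list_of_vec v)) @ [Semicolon]"

definition encode_mat :: "rat mat \<Rightarrow> letter list" where
  "encode_mat M = concat (map encode_row (rows M))"

definition encode_data :: "rat mat \<Rightarrow> rat mat \<Rightarrow> letter list" where
  "encode_data A G = encode_mat A @ [Hash] @ encode_mat G"

text \<open>A number depending on admissible data is polynomial-time computable if one machine computes
  it on all admissible rational data, of all dimensions, in time polynomial in the size of the
  data.\<close>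

definition poly_time_on_rational_data :: "(real mat \<Rightarrow> real mat \<Rightarrow> nat) \<Rightarrow> bool" where
  "poly_time_on_rational_data f \<longleftrightarrow>
     (\<exists>M (p :: nat poly). well_formed_tm M \<and>
        (\<forall>m n A G. admissible m n (map_mat real_of_rat A) (map_mat real_of_rat G) \<longrightarrow>
           computes_within M (encode_data A G)
             (encode_nat (f (map_mat real_of_rat A) (map_mat real_of_rat G)))
             (poly p (data_size A G))))"

end

theory Submission
  imports Defs
begin

text \<open>
  A pair \<open>(x, Q)\<close> feasible for the semidefinite program carries an ellipsoid, the set of all \<open>v\<close>
  with \<open>(w \<bullet> v)\<^sup>2 \<le> w \<bullet> Q w\<close> for all \<open>w\<close>, that is mapped into itself by \<open>G\<close>, lies in the polyhedron \<open>P\<close> and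
  contains \<open>G^r x\<close>. If \<open>H\<close> is the inverse of \<open>Q\<close>, the same ellipsoid is \<open>z \<bullet> H z \<le> 1\<close>. By the
  Cauchy-Schwarz inequality for the form \<open>H\<close>, each constraint on \<open>H\<close> is equivalent to the corresponding
  constraint on \<open>Q\<close> (\<open>feasible_N_iff_feasible_SDP\<close>). Passing to the inverse matrix does not touch \<open>x\<close>, so
  values, optimal vectors and optimal matrices of the two problems correspond.

  An orbit that has entered an invariant ellipsoid inside \<open>P\<close> never leaves \<open>P\<close>. Therefore the vectors
  feasible at level \<open>r\<close> stay feasible at level \<open>r + 1\<close>, with the same \<open>Q\<close> (\<open>feasible_SDP_mono\<close>), and are
  feasible for the R-LD-LP (\<open>feasible_SDP_imp_RLDLP\<close>). This gives the upper bounds and their monotonicity.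

  For exactness, a single ellipsoid has to capture \<open>G^r x\<close> for every R-LD-LP-feasible \<open>x\<close>. As the powers of
  \<open>G\<close> tend to \<open>0\<close>, the equation \<open>X = G X G\<^sup>T\<close> has only the trivial solution, so the Lyapunov equation
  \<open>Y - G Y G\<^sup>T = 1\<close> is solvable. Its solution satisfies \<open>1 \<le> Y \<le> lam\<close> as a quadratic form, and
  \<open>w \<bullet> Y w\<close> shrinks at least by the factor \<open>1 - 1/lam\<close> whenever \<open>w\<close> is replaced by \<open>G\<^sup>T w\<close>. If the squared norms of the points of \<open>P\<close>
  and of the rows of \<open>A\<close> are at most \<open>R\<close> and \<open>s\<close>, then \<open>Q = Y / (lam * s)\<close> works as soon as
  \<open>r \<ge> lam\<^sup>2 * R * s\<close> (\<open>RLDLP_feasible_imp_SDP\<close>).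

  For rational data, let \<open>N\<close> be the length of the input word. The entries of \<open>Y\<close> solve a linear system in
  \<open>n\<^sup>2\<close> unknowns, and every coordinate on \<open>P\<close> is bounded by its values at vertices, which solve the
  normal equations of their tight constraints. The entries and the common denominators of \<open>A\<close> and \<open>G\<close> are at most
  \<open>2 ^ N\<close>, so Cramer's rule bounds all these solutions by \<open>2\<close> to the power of a multiple of \<open>N\<^sup>2\<close>, and
  \<open>2 ^ (38 * N * N)\<close> is a sufficient number of steps (\<open>sufficient_step_rational\<close>). Only the number of
  binary digits of this number matters for the running time, and these digits are a \<open>One\<close> followed
  by \<open>38 * N * N\<close> \<open>Zero\<close>s. A machine can write them without any arithmetic, by
  sweeping once over a copy of the input for every input letter (\<open>zeros_tm_computes\<close>).
\<close>

section \<open>Quadratic forms and the Loewner order\<close>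

lemma sym_mat_swap:
  assumes "sym_mat M" "M \<in> carrier_mat n n" "x \<in> carrier_vec n" "y \<in> carrier_vec n"
  shows "x \<bullet> (M *\<^sub>v y) = y \<bullet> (M *\<^sub>v x)"
proof -
  have "x \<bullet> (M *\<^sub>v y) = (M *\<^sub>v y) \<bullet> x"
    using assms by (intro comm_scalar_prod[of _ n]) auto
  also have "\<dots> = y \<bullet> (M *\<^sub>v x)"
    using transpose_vec_mult_scalar[of M n n x y] assms by (auto simp: sym_mat_def)
  finally show ?thesis .
qed

lemma quad_form_add:
  assumes "sym_mat M" "M \<in> carrier_mat n n" "u \<in> carrier_vec n" "v \<in> carrier_vec n"
  shows "(u + t \<cdot>\<^sub>v v) \<bullet> (M *\<^sub>v (u + t \<cdot>\<^sub>v v))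
    = u \<bullet> (M *\<^sub>v u) + 2 * t * (u \<bullet> (M *\<^sub>v v)) + t\<^sup>2 * (v \<bullet> (M *\<^sub>v v))"
proof -
  have "(u + t \<cdot>\<^sub>v v) \<bullet> (M *\<^sub>v (u + t \<cdot>\<^sub>v v))
      = (u + t \<cdot>\<^sub>v v) \<bullet> (M *\<^sub>v u + t \<cdot>\<^sub>v (M *\<^sub>v v))"
    using assms by (simp add: mult_add_distrib_mat_vec[of _ n n] mult_mat_vec[of _ n n])
  also have "\<dots> = u \<bullet> (M *\<^sub>v u) + t * (u \<bullet> (M *\<^sub>v v)) + t * (v \<bullet> (M *\<^sub>v u)) + t * t * (v \<bullet> (M *\<^sub>v v))"
    using assms
    by (simp add: add_scalar_prod_distrib[of _ n] scalar_prod_add_distrib[of _ n] algebra_simps)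
  finally show ?thesis
    using sym_mat_swap[OF assms(1,2,4,3)] by (simp add: power2_eq_square)
qed

lemma pos_def_nonneg:
  assumes "pos_def M" "M \<in> carrier_mat n n" "v \<in> carrier_vec n"
  shows "0 \<le> v \<bullet> (M *\<^sub>v v)"
  using assms by (cases "v = 0\<^sub>v n") (auto simp: pos_def_def less_imp_le)

text \<open>The form is nonnegative at every \<open>u + t v\<close>, in particular at the minimizing \<open>t\<close>.\<close>

lemma pos_def_cauchy_schwarz:
  assumes "pos_def M" "M \<in> carrier_mat n n" "u \<in> carrier_vec n" "v \<in> carrier_vec n"
  shows "(u \<bullet> (M *\<^sub>v v))\<^sup>2 \<le> (u \<bullet> (M *\<^sub>v u)) * (v \<bullet> (M *\<^sub>v v))"
proof (cases "v = 0\<^sub>v n")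
  case True
  have "M *\<^sub>v 0\<^sub>v n = 0\<^sub>v n"
    using assms by (intro eq_vecI) auto
  then show ?thesis using True assms by simp
next
  case False
  define d where "d = v \<bullet> (M *\<^sub>v v)"
  define b where "b = u \<bullet> (M *\<^sub>v v)"
  have d: "d > 0"
    using assms False by (auto simp: pos_def_def d_def)
  have "sym_mat M"
    using assms by (simp add: pos_def_def)
  \<comment> \<open>The minimizing parameter is \<open>t = - b / d\<close>.\<close>
  then have "(u + (- b / d) \<cdot>\<^sub>v v) \<bullet> (M *\<^sub>v (u + (- b / d) \<cdot>\<^sub>v v))
      = u \<bullet> (M *\<^sub>v u) + 2 * (- b / d) * b + (- b / d)\<^sup>2 * d"
    unfolding b_def d_def using assms by (intro quad_form_add)
  moreover have "0 \<le> (u + (- b / d) \<cdot>\<^sub>v v) \<bullet> (M *\<^sub>v (u + (- b / d) \<cdot>\<^sub>v v))"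
    using assms by (intro pos_def_nonneg[of _ n]) auto
  ultimately have "0 \<le> u \<bullet> (M *\<^sub>v u) + 2 * (- b / d) * b + (- b / d)\<^sup>2 * d"
    by simp
  also have "\<dots> = u \<bullet> (M *\<^sub>v u) - b\<^sup>2 / d"
    using d by (simp add: power2_eq_square field_simps)
  finally have "0 \<le> u \<bullet> (M *\<^sub>v u) - b\<^sup>2 / d" .
  then show ?thesis
    using d by (simp add: field_simps flip: b_def d_def)
qed

lemma congruence_quad_form:
  fixes M B :: "real mat"
  assumes "M \<in> carrier_mat n n" "B \<in> carrier_mat n n" "v \<in> carrier_vec n"
  shows "v \<bullet> ((B\<^sup>T * M * B) *\<^sub>v v) = (B *\<^sub>v v) \<bullet> (M *\<^sub>v (B *\<^sub>v v))"
proof -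
  have "(B\<^sup>T * M * B) *\<^sub>v v = B\<^sup>T *\<^sub>v (M *\<^sub>v (B *\<^sub>v v))"
    using assms by (simp add: assoc_mult_mat_vec[of _ n n _ n])
  moreover have "((B\<^sup>T)\<^sup>T *\<^sub>v v) \<bullet> (M *\<^sub>v (B *\<^sub>v v)) = v \<bullet> (B\<^sup>T *\<^sub>v (M *\<^sub>v (B *\<^sub>v v)))"
    using assms by (intro transpose_vec_mult_scalar[of "B\<^sup>T" n n "M *\<^sub>v (B *\<^sub>v v)" v]) auto
  ultimately show ?thesis by simp
qed

lemma sym_mat_congruence:
  assumes "sym_mat M" "M \<in> carrier_mat n n" "B \<in> carrier_mat n n"
  shows "sym_mat (B\<^sup>T * M * B)"
proof -
  have "(B\<^sup>T * M * B)\<^sup>T = B\<^sup>T * (B\<^sup>T * M)\<^sup>T"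
    using assms by (simp add: transpose_mult[of _ n n _ n])
  also have "\<dots> = B\<^sup>T * (M * B)"
    using assms by (simp add: transpose_mult[of _ n n _ n] sym_mat_def)
  also have "\<dots> = B\<^sup>T * M * B"
    using assms by (simp add: assoc_mult_mat[of _ n n _ n _ n])
  finally show ?thesis using assms by (auto simp: sym_mat_def)
qed

lemma loewner_le_iff:
  assumes "sym_mat M" "M \<in> carrier_mat n n" "sym_mat N" "N \<in> carrier_mat n n"
  shows "M \<preceq>\<^sub>L N \<longleftrightarrow> (\<forall>v \<in> carrier_vec n. v \<bullet> (M *\<^sub>v v) \<le> v \<bullet> (N *\<^sub>v v))"
proof -
  have "sym_mat (N - M)"
    using assms transpose_minus[of N n n M] by (auto simp: sym_mat_def)
  moreover have "v \<bullet> ((N - M) *\<^sub>v v) = v \<bullet> (N *\<^sub>v v) - v \<bullet> (M *\<^sub>v v)" if "v \<in> carrier_vec n" for v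
    using assms that by (simp add: minus_mult_distrib_mat_vec[of _ n n] scalar_prod_minus_distrib[of _ n])
  ultimately show ?thesis
    using assms by (auto simp: loewner_le_def pos_semidef_def)
qed

text \<open>Both invariance constraints have this shape: \<open>G\<^sup>T H G \<preceq> H\<close> with \<open>B = G\<close>, and
  \<open>G Q G\<^sup>T \<preceq> Q\<close> with \<open>B = G\<^sup>T\<close>.\<close>

lemma loewner_le_congruence_iff:
  assumes "sym_mat M" "M \<in> carrier_mat n n" "B \<in> carrier_mat n n"
  shows "B\<^sup>T * M * B \<preceq>\<^sub>L M \<longleftrightarrow>
    (\<forall>v \<in> carrier_vec n. (B *\<^sub>v v) \<bullet> (M *\<^sub>v (B *\<^sub>v v)) \<le> v \<bullet> (M *\<^sub>v v))"
  using assms sym_mat_congruence[OF assms]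
  by (subst loewner_le_iff[of _ n]) (auto simp: congruence_quad_form[of _ n] simp del: assoc_mult_mat)

lemma scalar_prod_self_pos:
  fixes v :: "real vec"
  assumes v: "v \<in> carrier_vec n" "v \<noteq> 0\<^sub>v n"
  shows "v \<bullet> v > 0"
proof -
  obtain i where i: "i < n" "v $ i \<noteq> 0"
    using v by (auto simp: vec_eq_iff)
  have "0 < (\<Sum>j = 0..<n. (v $ j)\<^sup>2)"
    using i by (intro sum_pos2[of _ i]) auto
  then show ?thesis using v by (simp add: scalar_prod_def power2_eq_square)
qed

lemma pos_def_one: "pos_def (1\<^sub>m n)"
  using scalar_prod_self_pos by (auto simp: pos_def_def sym_mat_def)

section \<open>Ellipsoids and bordered matrices\<close>

text \<open>For positive definite \<open>Q\<close> this is the ellipsoid of all \<open>v\<close> with \<open>v \<bullet> Q\<^sup>-\<^sup>1 v \<le> 1\<close>. It is described by its support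
  function, the square root of \<open>w \<bullet> Q w\<close>, so that no inverse occurs and images under \<open>G\<close> can be followed by
  moving \<open>G\<^sup>T\<close> to the test vector \<open>w\<close>.\<close>

definition in_ellipsoid :: "real mat \<Rightarrow> real vec \<Rightarrow> bool" where
  "in_ellipsoid Q v \<longleftrightarrow>
     v \<in> carrier_vec (dim_row Q) \<and> (\<forall>w \<in> carrier_vec (dim_row Q). (w \<bullet> v)\<^sup>2 \<le> w \<bullet> (Q *\<^sub>v w))"

lemma scalar_prod_singleton: "vec 1 (\<lambda>_. t) \<bullet> vec 1 (\<lambda>_. s) = t * (s::real)"
  by (simp add: scalar_prod_def)

lemma bordered_quad_form:
  assumes "Q \<in> carrier_mat n n" "v \<in> carrier_vec n" "w \<in> carrier_vec n"
  shows "(w @\<^sub>v vec 1 (\<lambda>_. t)) \<bullet> (bordered_mat Q v *\<^sub>v (w @\<^sub>v vec 1 (\<lambda>_. t)))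
    = w \<bullet> (Q *\<^sub>v w) + 2 * t * (w \<bullet> v) + t\<^sup>2"
proof -
  let ?t = "vec 1 (\<lambda>_. t) :: real vec"
  have col: "mat_of_cols (dim_vec v) [v] *\<^sub>v ?t = t \<cdot>\<^sub>v v"
    using assms by (intro eq_vecI) (auto simp: scalar_prod_def mat_of_cols_def)
  have row: "mat_of_rows (dim_vec v) [v] *\<^sub>v w = vec 1 (\<lambda>_. w \<bullet> v)"
    using assms comm_scalar_prod[of v n w] by (intro eq_vecI) (auto simp: mat_of_rows_row)
  have "bordered_mat Q v *\<^sub>v (w @\<^sub>v ?t)
      = (Q *\<^sub>v w + mat_of_cols (dim_vec v) [v] *\<^sub>v ?t) @\<^sub>v
        (mat_of_rows (dim_vec v) [v] *\<^sub>v w + 1\<^sub>m 1 *\<^sub>v ?t)"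
    unfolding bordered_mat_def using assms by (intro four_block_mat_mult_vec[of _ n n _ 1 _ 1]) auto
  also have "\<dots> = (Q *\<^sub>v w + t \<cdot>\<^sub>v v) @\<^sub>v (vec 1 (\<lambda>_. w \<bullet> v) + ?t)"
    unfolding col row by simp
  also have "vec 1 (\<lambda>_. w \<bullet> v) + ?t = vec 1 (\<lambda>_. w \<bullet> v + t)"
    by (intro eq_vecI) auto
  finally have "(w @\<^sub>v ?t) \<bullet> (bordered_mat Q v *\<^sub>v (w @\<^sub>v ?t))
      = w \<bullet> (Q *\<^sub>v w + t \<cdot>\<^sub>v v) + ?t \<bullet> vec 1 (\<lambda>_. w \<bullet> v + t)"
    using assms by (simp add: scalar_prod_append[of _ n _ 1])
  then show ?thesis
    using assms unfolding scalar_prod_singleton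
    by (simp add: scalar_prod_add_distrib[of _ n] power2_eq_square algebra_simps)
qed

text \<open>The bordered matrix has the quadratic form \<open>w \<bullet> Q w + 2 t (w \<bullet> v) + t\<^sup>2\<close>. For fixed \<open>w\<close> its minimum over \<open>t\<close>
  is \<open>w \<bullet> Q w - (w \<bullet> v)\<^sup>2\<close>.\<close>

lemma bordered_psd_iff_in_ellipsoid:
  assumes "sym_mat Q" "Q \<in> carrier_mat n n" "v \<in> carrier_vec n"
  shows "pos_semidef (bordered_mat Q v) \<longleftrightarrow> in_ellipsoid Q v"
proof -
  have dim: "bordered_mat Q v \<in> carrier_mat (n + 1) (n + 1)"
    using assms by (auto simp: bordered_mat_def intro!: four_block_carrier_mat)
  have "(mat_of_cols n [v])\<^sup>T = mat_of_rows n [v]" "(mat_of_rows n [v])\<^sup>T = mat_of_cols n [v]"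
    by (auto simp: transpose_mat_of_cols transpose_mat_of_rows)
  moreover have "mat_of_cols n [v] \<in> carrier_mat n 1" "mat_of_rows n [v] \<in> carrier_mat 1 n"
    using mat_of_cols_carrier(1)[of n "[v]"] mat_of_rows_carrier(1)[of n "[v]"] by simp_all
  then have "(bordered_mat Q v)\<^sup>T = four_block_mat Q\<^sup>T (mat_of_rows n [v])\<^sup>T (mat_of_cols n [v])\<^sup>T (1\<^sub>m 1)\<^sup>T"
    using assms unfolding bordered_mat_def by (auto intro!: transpose_four_block_mat)
  ultimately have sym: "sym_mat (bordered_mat Q v)"
    using assms dim by (auto simp: sym_mat_def bordered_mat_def)
  have split: "\<exists>w t. w \<in> carrier_vec n \<and> z = w @\<^sub>v vec 1 (\<lambda>_. t)" if "z \<in> carrier_vec (n + 1)" for z :: "real vec"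
    using that
    by (intro exI[of _ "vec_first z n"] exI[of _ "z $ n"])
       (auto intro!: eq_vecI simp: vec_first_def less_Suc_eq)
  have "pos_semidef (bordered_mat Q v) \<longleftrightarrow>
      (\<forall>w \<in> carrier_vec n. \<forall>t. 0 \<le> w \<bullet> (Q *\<^sub>v w) + 2 * t * (w \<bullet> v) + t\<^sup>2)"
  proof
    assume L: "pos_semidef (bordered_mat Q v)"
    show "\<forall>w \<in> carrier_vec n. \<forall>t. 0 \<le> w \<bullet> (Q *\<^sub>v w) + 2 * t * (w \<bullet> v) + t\<^sup>2"
    proof (intro ballI allI)
      fix w :: "real vec" and t :: real assume w: "w \<in> carrier_vec n"
      have "w @\<^sub>v vec 1 (\<lambda>_. t) \<in> carrier_vec (n + 1)"
        using w by (intro append_carrier_vec) auto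
      then show "0 \<le> w \<bullet> (Q *\<^sub>v w) + 2 * t * (w \<bullet> v) + t\<^sup>2"
        using L dim bordered_quad_form[OF assms(2,3) w, of t] unfolding pos_semidef_def by fastforce
    qed
  next
    assume R: "\<forall>w \<in> carrier_vec n. \<forall>t. 0 \<le> w \<bullet> (Q *\<^sub>v w) + 2 * t * (w \<bullet> v) + t\<^sup>2"
    have "0 \<le> z \<bullet> (bordered_mat Q v *\<^sub>v z)" if "z \<in> carrier_vec (n + 1)" for z
      using split[OF that] R bordered_quad_form[OF assms(2,3)] by auto
    then show "pos_semidef (bordered_mat Q v)"
      using sym dim by (auto simp: pos_semidef_def)
  qed
  also have "\<dots> \<longleftrightarrow> (\<forall>w \<in> carrier_vec n. (w \<bullet> v)\<^sup>2 \<le> w \<bullet> (Q *\<^sub>v w))"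
  proof (intro ball_cong refl iffI allI)
    fix w assume "\<forall>t. 0 \<le> w \<bullet> (Q *\<^sub>v w) + 2 * t * (w \<bullet> v) + t\<^sup>2"
    from spec[OF this, of "- (w \<bullet> v)"] show "(w \<bullet> v)\<^sup>2 \<le> w \<bullet> (Q *\<^sub>v w)"
      by (simp add: power2_eq_square)
  next
    fix w t assume "(w \<bullet> v)\<^sup>2 \<le> w \<bullet> (Q *\<^sub>v w)"
    moreover have "0 \<le> (w \<bullet> v + t)\<^sup>2" by simp
    ultimately show "0 \<le> w \<bullet> (Q *\<^sub>v w) + 2 * t * (w \<bullet> v) + t\<^sup>2"
      unfolding power2_sum by (simp add: algebra_simps)
  qed
  finally show ?thesis
    using assms by (auto simp: in_ellipsoid_def)
qed

section \<open>Polarity between H and its inverse\<close>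

lemma pos_def_inverse:
  assumes H: "pos_def H" "H \<in> carrier_mat n n"
  obtains Q where "pos_def Q" "Q \<in> carrier_mat n n" "H * Q = 1\<^sub>m n" "Q * H = 1\<^sub>m n"
proof -
  have d: "det H \<noteq> 0"
  proof
    assume "det H = 0"
    then obtain v where v: "v \<in> carrier_vec n" "v \<noteq> 0\<^sub>v n" "H *\<^sub>v v = 0\<^sub>v n"
      using det_0_iff_vec_prod_zero[OF H(2)] by auto
    then have "v \<bullet> (H *\<^sub>v v) > 0" using H by (auto simp: pos_def_def)
    with v show False by simp
  qed
  define Q where "Q = (1 / det H) \<cdot>\<^sub>m adj_mat H"
  have Q: "Q \<in> carrier_mat n n" "H * Q = 1\<^sub>m n" "Q * H = 1\<^sub>m n"
    using adj_mat[OF H(2)] H(2) d by (auto simp: Q_def mult_smult_distrib[of _ n n _ n] mult_smult_assoc_mat[of _ n n _ n])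
  have "Q\<^sup>T = Q\<^sup>T * (H * Q)" using Q by simp
  also have "\<dots> = (Q\<^sup>T * H) * Q" using Q H by (simp add: assoc_mult_mat[of _ n n _ n _ n])
  also have "Q\<^sup>T * H = (H * Q)\<^sup>T"
    using Q(1) H by (simp add: transpose_mult[of _ n n _ n] pos_def_def sym_mat_def)
  finally have sym: "Q\<^sup>T = Q" using Q by simp
  have "v \<bullet> (Q *\<^sub>v v) > 0" if v: "v \<in> carrier_vec n" "v \<noteq> 0\<^sub>v n" for v
  proof -
    define u where "u = Q *\<^sub>v v"
    have u: "u \<in> carrier_vec n" using Q v by (simp add: u_def)
    have vu: "H *\<^sub>v u = v"
      using H Q(1) v by (simp add: u_def flip: assoc_mult_mat_vec) (simp add: Q(2))
    have "u \<noteq> 0\<^sub>v n"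
    proof
      assume "u = 0\<^sub>v n"
      then have "v = 0\<^sub>v n" using vu H(2) by (auto intro!: eq_vecI)
      with v show False by simp
    qed
    then have "u \<bullet> (H *\<^sub>v u) > 0" using H u by (auto simp: pos_def_def)
    then show ?thesis
      using vu comm_scalar_prod[OF u v(1)] by (simp add: u_def)
  qed
  with Q(1) sym have "pos_def Q" by (auto simp: pos_def_def sym_mat_def)
  with Q that show ?thesis by blast
qed

lemma inverse_quad_form:
  fixes H Q :: "real mat"
  assumes "H * Q = 1\<^sub>m n" "H \<in> carrier_mat n n" "Q \<in> carrier_mat n n" "x \<in> carrier_vec n"
  shows "(Q *\<^sub>v x) \<bullet> (H *\<^sub>v (Q *\<^sub>v x)) = x \<bullet> (Q *\<^sub>v x)"
proof -
  have "H *\<^sub>v (Q *\<^sub>v x) = (H * Q) *\<^sub>v x"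
    using assms(2,3,4) by (simp add: assoc_mult_mat_vec[of _ n n _ n])
  then have "H *\<^sub>v (Q *\<^sub>v x) = x" using assms by simp
  then show ?thesis using assms comm_scalar_prod[of x n "Q *\<^sub>v x"] by simp
qed

text \<open>Since \<open>w \<bullet> v = (Q w) \<bullet> H v\<close>, this is the Cauchy-Schwarz inequality for the form \<open>H\<close>. All the
  equivalences between constraints on \<open>H\<close> and constraints on \<open>Q\<close> rest on it.\<close>

lemma inverse_cauchy_schwarz:
  assumes "pos_def H" "H * Q = 1\<^sub>m n" "H \<in> carrier_mat n n" "Q \<in> carrier_mat n n"
    and "sym_mat Q" "Q * H = 1\<^sub>m n" "w \<in> carrier_vec n" "v \<in> carrier_vec n"
  shows "(w \<bullet> v)\<^sup>2 \<le> (w \<bullet> (Q *\<^sub>v w)) * (v \<bullet> (H *\<^sub>v v))"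
proof -
  have Hv: "H *\<^sub>v v \<in> carrier_vec n" and Qw: "Q *\<^sub>v w \<in> carrier_vec n"
    using assms by auto
  have "(Q *\<^sub>v w) \<bullet> (H *\<^sub>v v) = (H *\<^sub>v v) \<bullet> (Q *\<^sub>v w)"
    using Hv Qw by (rule comm_scalar_prod[rotated])
  also have "\<dots> = w \<bullet> (Q *\<^sub>v (H *\<^sub>v v))"
    using assms Hv by (intro sym_mat_swap[of _ n]) auto
  also have "Q *\<^sub>v (H *\<^sub>v v) = (Q * H) *\<^sub>v v"
    using assms(3,4,8) by (simp add: assoc_mult_mat_vec[of _ n n _ n])
  also have "\<dots> = v" using assms by simp
  finally have "(Q *\<^sub>v w) \<bullet> (H *\<^sub>v v) = w \<bullet> v" .
  then show ?thesis
    using pos_def_cauchy_schwarz[OF assms(1,3) Qw assms(8)] inverse_quad_form[OF assms(2,3,4,7)] by simp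
qed

text \<open>In the norm of \<open>H\<close> the hypothesis says that \<open>G\<close> is a contraction, and the conclusion says the same of its
  adjoint \<open>G\<^sup>T\<close> in the dual norm, whose form is \<open>Q\<close>. As \<open>H\<close> and \<open>Q\<close> enter symmetrically, the converse is the same
  lemma for \<open>G\<^sup>T\<close>.\<close>

lemma invariance_dual:
  assumes "pos_def H" "H \<in> carrier_mat n n" "pos_def Q" "Q \<in> carrier_mat n n"
    and "H * Q = 1\<^sub>m n" "Q * H = 1\<^sub>m n" and G: "G \<in> carrier_mat n n"
    and "G\<^sup>T * H * G \<preceq>\<^sub>L H"
  shows "G * Q * G\<^sup>T \<preceq>\<^sub>L Q"
proof -
  have sym: "sym_mat H" "sym_mat Q" using assms by (auto simp: pos_def_def)
  have contr: "(G *\<^sub>v v) \<bullet> (H *\<^sub>v (G *\<^sub>v v)) \<le> v \<bullet> (H *\<^sub>v v)" if "v \<in> carrier_vec n" for v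
    using assms sym that loewner_le_congruence_iff[of H n G] by blast
  have "(G\<^sup>T *\<^sub>v w) \<bullet> (Q *\<^sub>v (G\<^sup>T *\<^sub>v w)) \<le> w \<bullet> (Q *\<^sub>v w)" if w: "w \<in> carrier_vec n" for w
  proof -
    define u where "u = G\<^sup>T *\<^sub>v w"
    define s where "s = u \<bullet> (Q *\<^sub>v u)"
    have u: "u \<in> carrier_vec n" using G w by (simp add: u_def)
    have Qu: "Q *\<^sub>v u \<in> carrier_vec n" using assms u by simp
    have s0: "0 \<le> s" using assms u by (auto simp: s_def intro: pos_def_nonneg)
    \<comment> \<open>The Cauchy-Schwarz inequality gives \<open>s\<^sup>2 \<le> (w \<bullet> Q w) * s\<close>, from which one factor \<open>s\<close> is cancelled.\<close>
    have "s = w \<bullet> (G *\<^sub>v (Q *\<^sub>v u))"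
      unfolding s_def u_def using transpose_vec_mult_scalar[OF G Qu w] by (simp add: u_def)
    then have "s\<^sup>2 \<le> (w \<bullet> (Q *\<^sub>v w)) * ((G *\<^sub>v (Q *\<^sub>v u)) \<bullet> (H *\<^sub>v (G *\<^sub>v (Q *\<^sub>v u))))"
      using inverse_cauchy_schwarz[of H Q n w "G *\<^sub>v (Q *\<^sub>v u)"] assms sym w Qu by simp
    also have "\<dots> \<le> (w \<bullet> (Q *\<^sub>v w)) * ((Q *\<^sub>v u) \<bullet> (H *\<^sub>v (Q *\<^sub>v u)))"
      using contr[OF Qu] pos_def_nonneg[OF assms(3,4) w] by (intro mult_left_mono) auto
    also have "(Q *\<^sub>v u) \<bullet> (H *\<^sub>v (Q *\<^sub>v u)) = s"
      using inverse_quad_form[of H Q n u] assms u by (simp add: s_def)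
    finally have "s \<le> w \<bullet> (Q *\<^sub>v w)"
      using s0 pos_def_nonneg[OF assms(3,4) w]
      by (cases "s = 0") (auto simp: power2_eq_square)
    then show ?thesis by (simp add: s_def u_def)
  qed
  then show ?thesis
    using loewner_le_congruence_iff[of Q n "G\<^sup>T"] assms sym by simp
qed

text \<open>The largest value of \<open>a \<bullet> z\<close> on the ellipsoid \<open>z \<bullet> H z \<le> 1\<close> is the square root of \<open>a \<bullet> Q a\<close>.\<close>

lemma polar_constraint_iff:
  assumes "pos_def H" "H \<in> carrier_mat n n" "pos_def Q" "Q \<in> carrier_mat n n"
    and "H * Q = 1\<^sub>m n" "Q * H = 1\<^sub>m n" and a: "a \<in> carrier_vec n"
  shows "(\<forall>z \<in> carrier_vec n. z \<bullet> (H *\<^sub>v z) \<le> 1 \<longrightarrow> a \<bullet> z \<le> 1) \<longleftrightarrow> a \<bullet> (Q *\<^sub>v a) \<le> 1"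
proof -
  have sym: "sym_mat H" "sym_mat Q" using assms by (auto simp: pos_def_def)
  define s where "s = a \<bullet> (Q *\<^sub>v a)"
  have s0: "0 \<le> s" using assms by (auto simp: s_def intro: pos_def_nonneg)
  show ?thesis
  proof
    assume L: "\<forall>z \<in> carrier_vec n. z \<bullet> (H *\<^sub>v z) \<le> 1 \<longrightarrow> a \<bullet> z \<le> 1"
    show "a \<bullet> (Q *\<^sub>v a) \<le> 1"
    proof (rule ccontr)
      assume "\<not> a \<bullet> (Q *\<^sub>v a) \<le> 1"
      then have s1: "s > 1" by (simp add: s_def)
      \<comment> \<open>The point of the ellipsoid at which \<open>a \<bullet> z\<close> is largest.\<close>
      define z where "z = (1 / sqrt s) \<cdot>\<^sub>v (Q *\<^sub>v a)"
      have Qa: "Q *\<^sub>v a \<in> carrier_vec n" using assms by simp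
      have z: "z \<in> carrier_vec n" using Qa by (simp add: z_def)
      have Hz: "H *\<^sub>v z = (1 / sqrt s) \<cdot>\<^sub>v (H *\<^sub>v (Q *\<^sub>v a))"
        unfolding z_def using assms Qa by (intro mult_mat_vec) auto
      have "z \<bullet> (H *\<^sub>v z) = (1 / sqrt s) * (1 / sqrt s) * ((Q *\<^sub>v a) \<bullet> (H *\<^sub>v (Q *\<^sub>v a)))"
        unfolding Hz using assms Qa by (simp add: z_def)
      also have "\<dots> = (1 / sqrt s) * (1 / sqrt s) * s"
        using inverse_quad_form[of H Q n a] assms by (simp add: s_def)
      also have "\<dots> = 1" using s1 by simp
      finally have "a \<bullet> z \<le> 1" using L z by simp
      moreover have "a \<bullet> z = (1 / sqrt s) * s" using a Qa by (simp add: z_def s_def)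
      moreover have "(1 / sqrt s) * s = sqrt s" using s1 by (simp add: real_div_sqrt)
      ultimately have "sqrt s \<le> 1" by simp
      then show False using s1 by simp
    qed
  next
    assume R: "a \<bullet> (Q *\<^sub>v a) \<le> 1"
    show "\<forall>z \<in> carrier_vec n. z \<bullet> (H *\<^sub>v z) \<le> 1 \<longrightarrow> a \<bullet> z \<le> 1"
    proof (intro ballI impI)
      fix z assume z: "z \<in> carrier_vec n" "z \<bullet> (H *\<^sub>v z) \<le> 1"
      have "(a \<bullet> z)\<^sup>2 \<le> (a \<bullet> (Q *\<^sub>v a)) * (z \<bullet> (H *\<^sub>v z))"
        using assms sym z by (intro inverse_cauchy_schwarz[of H Q n]) auto
      also have "\<dots> \<le> 1 * 1"
        using R z pos_def_nonneg[OF assms(1,2) z(1)] by (intro mult_mono) auto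
      finally show "a \<bullet> z \<le> 1" using power2_le_imp_le[of "a \<bullet> z" 1] by simp
    qed
  qed
qed

lemma in_ellipsoid_inverse_iff:
  assumes "pos_def H" "H \<in> carrier_mat n n" "pos_def Q" "Q \<in> carrier_mat n n"
    and "H * Q = 1\<^sub>m n" "Q * H = 1\<^sub>m n" and v: "v \<in> carrier_vec n"
  shows "in_ellipsoid Q v \<longleftrightarrow> v \<bullet> (H *\<^sub>v v) \<le> 1"
proof -
  have sym: "sym_mat H" "sym_mat Q" using assms by (auto simp: pos_def_def)
  have Hv: "H *\<^sub>v v \<in> carrier_vec n" using assms by simp
  show ?thesis
  proof
    assume "in_ellipsoid Q v"
    \<comment> \<open>For the test vector \<open>H v\<close> the inequality reads \<open>(v \<bullet> H v)\<^sup>2 \<le> v \<bullet> H v\<close>.\<close>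
    then have "((H *\<^sub>v v) \<bullet> v)\<^sup>2 \<le> (H *\<^sub>v v) \<bullet> (Q *\<^sub>v (H *\<^sub>v v))"
      using Hv assms by (auto simp: in_ellipsoid_def)
    also have "\<dots> = v \<bullet> (H *\<^sub>v v)"
      using inverse_quad_form[of Q H n v] assms by simp
    finally have "(v \<bullet> (H *\<^sub>v v))\<^sup>2 \<le> v \<bullet> (H *\<^sub>v v)"
      using comm_scalar_prod[OF v Hv] by simp
    then show "v \<bullet> (H *\<^sub>v v) \<le> 1"
      using pos_def_nonneg[OF assms(1,2) v]
      by (cases "v \<bullet> (H *\<^sub>v v) = 0") (auto simp: power2_eq_square)
  next
    assume R: "v \<bullet> (H *\<^sub>v v) \<le> 1"
    have "(w \<bullet> v)\<^sup>2 \<le> w \<bullet> (Q *\<^sub>v w)" if w: "w \<in> carrier_vec n" for w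
    proof -
      have "(w \<bullet> v)\<^sup>2 \<le> (w \<bullet> (Q *\<^sub>v w)) * (v \<bullet> (H *\<^sub>v v))"
        using assms sym w by (intro inverse_cauchy_schwarz[of H Q n]) auto
      also have "\<dots> \<le> (w \<bullet> (Q *\<^sub>v w)) * 1"
        using R pos_def_nonneg[OF assms(3,4) w] by (intro mult_left_mono) auto
      finally show ?thesis by simp
    qed
    then show "in_ellipsoid Q v" using assms by (auto simp: in_ellipsoid_def)
  qed
qed

lemma mult_le_ones_iff:
  assumes "A \<in> carrier_mat m n"
  shows "A *\<^sub>v z \<le> ones_vec m \<longleftrightarrow> (\<forall>i<m. row A i \<bullet> z \<le> 1)"
  using assms by (auto simp: less_eq_vec_def ones_vec_def)

text \<open>The two problems impose the same conditions on the ellipsoid. They describe it by its gauge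
  (\<open>H\<close>) and by its support function (\<open>Q\<close>).\<close>

lemma feasible_N_iff_feasible_SDP:
  assumes A: "A \<in> carrier_mat m n" and G: "G \<in> carrier_mat n n"
    and HQ: "pos_def H" "H \<in> carrier_mat n n" "pos_def Q" "Q \<in> carrier_mat n n"
    "H * Q = 1\<^sub>m n" "Q * H = 1\<^sub>m n"
  shows "(x, H) \<in> feasible_N A G r \<longleftrightarrow> (x, Q) \<in> feasible_SDP A G r"
proof -
  have rows: "row A i \<in> carrier_vec n" if "i < m" for i using A that by auto
  have "G\<^sup>T * H * G \<preceq>\<^sub>L H \<longleftrightarrow> G * Q * G\<^sup>T \<preceq>\<^sub>L Q"
    using invariance_dual[of H n Q G] invariance_dual[of Q n H "G\<^sup>T"] HQ G by auto
  moreover have "(\<forall>z \<in> carrier_vec n. z \<bullet> (H *\<^sub>v z) \<le> 1 \<longrightarrow> A *\<^sub>v z \<le> ones_vec m)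
      \<longleftrightarrow> (\<forall>i<m. row A i \<bullet> (Q *\<^sub>v row A i) \<le> 1)"
    using polar_constraint_iff[OF HQ rows] mult_le_ones_iff[OF A] by blast
  moreover have "((G ^\<^sub>m r) *\<^sub>v x) \<bullet> (H *\<^sub>v ((G ^\<^sub>m r) *\<^sub>v x)) \<le> 1
      \<longleftrightarrow> pos_semidef (bordered_mat Q ((G ^\<^sub>m r) *\<^sub>v x))" if x: "x \<in> carrier_vec n"
  proof -
    have v: "(G ^\<^sub>m r) *\<^sub>v x \<in> carrier_vec n"
      using G x by (meson mult_mat_vec_carrier pow_carrier_mat)
    show ?thesis
      using in_ellipsoid_inverse_iff[OF HQ v] bordered_psd_iff_in_ellipsoid[of Q n, OF _ _ v] HQ
      by (auto simp: pos_def_def)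
  qed
  ultimately show ?thesis
    using A HQ by (auto simp: feasible_N_def feasible_SDP_def)
qed

lemma feasible_SDP_if_feasible_N:
  assumes "A \<in> carrier_mat m n" "G \<in> carrier_mat n n" "(x, H) \<in> feasible_N A G r"
  shows "\<exists>Q. mutually_inverse H Q \<and> (x, Q) \<in> feasible_SDP A G r"
proof -
  have H: "pos_def H" "H \<in> carrier_mat n n" using assms by (auto simp: feasible_N_def)
  obtain Q where Q: "pos_def Q" "Q \<in> carrier_mat n n" "H * Q = 1\<^sub>m n" "Q * H = 1\<^sub>m n"
    using pos_def_inverse[OF H] by blast
  then show ?thesis
    using feasible_N_iff_feasible_SDP[OF assms(1,2) H Q] assms(3) H
    by (auto simp: mutually_inverse_def inverts_mat_def)
qed

lemma feasible_N_if_feasible_SDP: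
  assumes "A \<in> carrier_mat m n" "G \<in> carrier_mat n n" "(x, Q) \<in> feasible_SDP A G r"
  shows "\<exists>H. mutually_inverse H Q \<and> (x, H) \<in> feasible_N A G r"
proof -
  have Q: "pos_def Q" "Q \<in> carrier_mat n n" using assms by (auto simp: feasible_SDP_def)
  obtain H where H: "pos_def H" "H \<in> carrier_mat n n" "Q * H = 1\<^sub>m n" "H * Q = 1\<^sub>m n"
    using pos_def_inverse[OF Q] by blast
  then show ?thesis
    using feasible_N_iff_feasible_SDP[OF assms(1,2) H(1,2) Q H(4,3)] assms(3) Q
    by (auto simp: mutually_inverse_def inverts_mat_def)
qed

lemma opt_value_lin_obj: "opt_value (lin_obj c) F = opt_value (\<lambda>x. c \<bullet> x) (fst ` F)"
  by (simp add: opt_value_def lin_obj_def image_image case_prod_unfold)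

text \<open>The objective ignores the matrix, so optimality only depends on the projection of the feasible set to the
  vectors. This reduces every comparison of two problems to a comparison of projections.\<close>

lemma is_optimal_lin_obj_iff:
  "is_optimal (lin_obj c) F (x, M) \<longleftrightarrow> (x, M) \<in> F \<and> is_optimal (\<lambda>x. c \<bullet> x) (fst ` F) x"
  by (force simp: is_optimal_def is_arg_min_def lin_obj_def case_prod_unfold)

lemma fst_optimal:
  "fst ` Collect (is_optimal (lin_obj c) F) = Collect (is_optimal (\<lambda>x. c \<bullet> x) (fst ` F))"
proof (intro equalityI subsetI)
  fix x assume "x \<in> fst ` Collect (is_optimal (lin_obj c) F)"
  then show "x \<in> Collect (is_optimal (\<lambda>x. c \<bullet> x) (fst ` F))"
    using is_optimal_lin_obj_iff by force
next
  fix x assume x: "x \<in> Collect (is_optimal (\<lambda>x. c \<bullet> x) (fst ` F))"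
  then have "x \<in> fst ` F" by (auto simp: is_optimal_def is_arg_min_def)
  then obtain M where "(x, M) \<in> F" by force
  then show "x \<in> fst ` Collect (is_optimal (lin_obj c) F)"
    using x is_optimal_lin_obj_iff[of c F x M] by force
qed

lemma fst_feasible_N:
  assumes "A \<in> carrier_mat m n" "G \<in> carrier_mat n n"
  shows "fst ` feasible_N A G r = fst ` feasible_SDP A G r"
proof (intro equalityI subsetI)
  fix x assume "x \<in> fst ` feasible_N A G r"
  then obtain H where "(x, H) \<in> feasible_N A G r" by auto
  then obtain Q where "(x, Q) \<in> feasible_SDP A G r"
    using feasible_SDP_if_feasible_N[OF assms] by blast
  then show "x \<in> fst ` feasible_SDP A G r" by (rule image_eqI[rotated]) simp
next
  fix x assume "x \<in> fst ` feasible_SDP A G r"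
  then obtain Q where "(x, Q) \<in> feasible_SDP A G r" by auto
  then obtain H where "(x, H) \<in> feasible_N A G r"
    using feasible_N_if_feasible_SDP[OF assms] by blast
  then show "x \<in> fst ` feasible_N A G r" by (rule image_eqI[rotated]) simp
qed

lemma N_equivalent_SDP:
  assumes "A \<in> carrier_mat m n" "G \<in> carrier_mat n n"
  shows "value_N c A G r = value_SDP c A G r"
    and "fst ` optimal_N c A G r = fst ` optimal_SDP c A G r"
    and "(x, H) \<in> optimal_N c A G r \<Longrightarrow> \<exists>Q. mutually_inverse H Q \<and> (x, Q) \<in> optimal_SDP c A G r"
    and "(x, Q) \<in> optimal_SDP c A G r \<Longrightarrow> \<exists>H. mutually_inverse H Q \<and> (x, H) \<in> optimal_N c A G r"
proof -
  show "value_N c A G r = value_SDP c A G r"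
    by (simp add: value_N_def value_SDP_def opt_value_lin_obj fst_feasible_N[OF assms])
  show "fst ` optimal_N c A G r = fst ` optimal_SDP c A G r"
    by (simp add: optimal_N_def optimal_SDP_def fst_optimal fst_feasible_N[OF assms])
  show "\<exists>Q. mutually_inverse H Q \<and> (x, Q) \<in> optimal_SDP c A G r" if "(x, H) \<in> optimal_N c A G r"
    using that feasible_SDP_if_feasible_N[OF assms, of x H r]
    by (auto simp: optimal_N_def optimal_SDP_def is_optimal_lin_obj_iff fst_feasible_N[OF assms])
  show "\<exists>H. mutually_inverse H Q \<and> (x, H) \<in> optimal_N c A G r" if "(x, Q) \<in> optimal_SDP c A G r"
    using that feasible_N_if_feasible_SDP[OF assms, of x Q r]
    by (auto simp: optimal_N_def optimal_SDP_def is_optimal_lin_obj_iff fst_feasible_N[OF assms])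
qed

section \<open>Invariant ellipsoids and growing feasible sets\<close>

lemma pow_mat_Suc_left:
  "G \<in> carrier_mat n n \<Longrightarrow> G ^\<^sub>m Suc k = G * G ^\<^sub>m k"
proof (induction k)
  case (Suc k)
  have "G ^\<^sub>m Suc (Suc k) = (G * G ^\<^sub>m k) * G" using Suc by (metis pow_mat.simps(2))
  also have "\<dots> = G * (G ^\<^sub>m k * G)"
    using Suc.prems by (intro assoc_mult_mat[of _ n n _ n _ n]) auto
  finally show ?case by simp
qed simp

lemma pow_mat_Suc_mult_vec:
  assumes "G \<in> carrier_mat n n" "x \<in> carrier_vec n"
  shows "G ^\<^sub>m Suc k *\<^sub>v x = G *\<^sub>v (G ^\<^sub>m k *\<^sub>v x)"
  unfolding pow_mat_Suc_left[OF assms(1)]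
  using assms by (intro assoc_mult_mat_vec[of _ n n _ n]) auto

lemma pow_mat_mult_vec_carrier:
  "G \<in> carrier_mat n n \<Longrightarrow> x \<in> carrier_vec n \<Longrightarrow> G ^\<^sub>m k *\<^sub>v x \<in> carrier_vec n"
  by (meson mult_mat_vec_carrier pow_carrier_mat)

text \<open>Testing \<open>G v\<close> against \<open>w\<close> is testing \<open>v\<close> against \<open>G\<^sup>T w\<close>, and the form \<open>Q\<close> does not increase from \<open>w\<close> to
  \<open>G\<^sup>T w\<close>.\<close>

lemma in_ellipsoid_image:
  assumes "sym_mat Q" and Q: "Q \<in> carrier_mat n n" and G: "G \<in> carrier_mat n n"
    and "G * Q * G\<^sup>T \<preceq>\<^sub>L Q" and v: "in_ellipsoid Q v"
  shows "in_ellipsoid Q (G *\<^sub>v v)"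
proof -
  have vn: "v \<in> carrier_vec n" using v Q by (auto simp: in_ellipsoid_def)
  have "(w \<bullet> (G *\<^sub>v v))\<^sup>2 \<le> w \<bullet> (Q *\<^sub>v w)" if w: "w \<in> carrier_vec n" for w
  proof -
    have Gw: "G\<^sup>T *\<^sub>v w \<in> carrier_vec n" using G w by simp
    have "(w \<bullet> (G *\<^sub>v v))\<^sup>2 = ((G\<^sup>T *\<^sub>v w) \<bullet> v)\<^sup>2"
      using transpose_vec_mult_scalar[OF G vn w] by simp
    also have "\<dots> \<le> (G\<^sup>T *\<^sub>v w) \<bullet> (Q *\<^sub>v (G\<^sup>T *\<^sub>v w))"
      using v Q Gw by (auto simp: in_ellipsoid_def)
    also have "\<dots> \<le> w \<bullet> (Q *\<^sub>v w)"
      using loewner_le_congruence_iff[of Q n "G\<^sup>T"] assms w by simp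
    finally show ?thesis .
  qed
  moreover have "dim_row Q = n" using Q by simp
  moreover have "G *\<^sub>v v \<in> carrier_vec n" using G vn by simp
  ultimately show ?thesis by (simp add: in_ellipsoid_def)
qed

lemma feasible_SDP_iff:
  assumes "A \<in> carrier_mat m n" "G \<in> carrier_mat n n"
  shows "(x, Q) \<in> feasible_SDP A G r \<longleftrightarrow>
    x \<in> carrier_vec n \<and> Q \<in> carrier_mat n n \<and> pos_def Q \<and> G * Q * G\<^sup>T \<preceq>\<^sub>L Q \<and>
    (\<forall>i<m. row A i \<bullet> (Q *\<^sub>v row A i) \<le> 1) \<and> in_ellipsoid Q (G ^\<^sub>m r *\<^sub>v x) \<and>
    (\<forall>k<r. \<forall>i<m. row A i \<bullet> (G ^\<^sub>m k *\<^sub>v x) \<le> 1)"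
proof -
  have "(A * G ^\<^sub>m k) *\<^sub>v x = A *\<^sub>v (G ^\<^sub>m k *\<^sub>v x)" if "x \<in> carrier_vec n" for k
    using assms that by (intro assoc_mult_mat_vec[of _ m n _ n]) auto
  then show ?thesis
    using assms bordered_psd_iff_in_ellipsoid[of Q n, OF _ _ pow_mat_mult_vec_carrier[OF assms(2)]]
    by (auto simp: feasible_SDP_def mult_le_ones_iff[OF assms(1)] pos_def_def)
qed

lemma feasible_RLDLP_iff:
  assumes "A \<in> carrier_mat m n" "G \<in> carrier_mat n n"
  shows "x \<in> feasible_RLDLP A G \<longleftrightarrow>
    x \<in> carrier_vec n \<and> (\<forall>k. \<forall>i<m. row A i \<bullet> (G ^\<^sub>m k *\<^sub>v x) \<le> 1)"
  using assms pow_mat_mult_vec_carrier[OF assms(2)]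
  by (auto simp: feasible_RLDLP_def polyhedron_le_one_def mult_le_ones_iff[OF assms(1)])

text \<open>The new constraint at time \<open>r\<close> holds because \<open>G^r x\<close> lies in the ellipsoid, which the rows of \<open>A\<close> bound by \<open>1\<close>.
  The ellipsoid also contains \<open>G^(r+1) x\<close> by invariance.\<close>

lemma feasible_SDP_Suc:
  assumes A: "A \<in> carrier_mat m n" and G: "G \<in> carrier_mat n n" and x: "(x, Q) \<in> feasible_SDP A G r"
  shows "(x, Q) \<in> feasible_SDP A G (Suc r)"
proof -
  let ?v = "G ^\<^sub>m r *\<^sub>v x"
  have *: "x \<in> carrier_vec n" "Q \<in> carrier_mat n n" "sym_mat Q" "pos_def Q" "G * Q * G\<^sup>T \<preceq>\<^sub>L Q"
    "\<forall>i<m. row A i \<bullet> (Q *\<^sub>v row A i) \<le> 1" "in_ellipsoid Q ?v"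
    "\<forall>k<r. \<forall>i<m. row A i \<bullet> (G ^\<^sub>m k *\<^sub>v x) \<le> 1"
    using x by (auto simp: feasible_SDP_iff[OF A G] pos_def_def)
  have "in_ellipsoid Q (G ^\<^sub>m Suc r *\<^sub>v x)"
    unfolding pow_mat_Suc_mult_vec[OF G *(1)] by (rule in_ellipsoid_image) (use * G in auto)
  moreover have "row A i \<bullet> ?v \<le> 1" if "i < m" for i
  proof -
    have "(row A i \<bullet> ?v)\<^sup>2 \<le> row A i \<bullet> (Q *\<^sub>v row A i)"
      using * A that by (auto simp: in_ellipsoid_def)
    also have "\<dots> \<le> 1" using *(6) that by blast
    finally show ?thesis using power2_le_imp_le[of "row A i \<bullet> ?v" 1] by simp
  qed
  ultimately show ?thesis
    using * by (auto simp: feasible_SDP_iff[OF A G] less_Suc_eq)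
qed

lemma feasible_SDP_mono:
  assumes "A \<in> carrier_mat m n" "G \<in> carrier_mat n n" "r \<le> s"
  shows "feasible_SDP A G r \<subseteq> feasible_SDP A G s"
  using assms(3) by (induction rule: dec_induct) (use feasible_SDP_Suc[OF assms(1,2)] in auto)

text \<open>The constraint at time \<open>k\<close> is one of the explicit constraints of level \<open>k + 1\<close>, and feasibility
  propagates to all higher levels.\<close>

lemma feasible_SDP_imp_RLDLP:
  assumes "A \<in> carrier_mat m n" "G \<in> carrier_mat n n"
  shows "fst ` feasible_SDP A G r \<subseteq> feasible_RLDLP A G"
proof (clarsimp simp: feasible_RLDLP_iff[OF assms])
  fix x Q assume x: "(x, Q) \<in> feasible_SDP A G r"
  show "x \<in> carrier_vec n \<and> (\<forall>k i. i < m \<longrightarrow> row A i \<bullet> (G ^\<^sub>m k *\<^sub>v x) \<le> 1)"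
  proof (intro conjI allI impI)
    show "x \<in> carrier_vec n" using x by (simp add: feasible_SDP_iff[OF assms])
    fix k i assume i: "i < m"
    \<comment> \<open>A level beyond \<open>k\<close>, at which the constraint at time \<open>k\<close> is explicit.\<close>
    have "(x, Q) \<in> feasible_SDP A G (max r (Suc k))"
      using x feasible_SDP_mono[OF assms, of r "max r (Suc k)"] by auto
    then show "row A i \<bullet> (G ^\<^sub>m k *\<^sub>v x) \<le> 1"
      using i by (auto simp: feasible_SDP_iff[OF assms])
  qed
qed

section \<open>Size bounds for solutions of linear systems\<close>

lemma det_Ints:
  fixes M :: "real mat"
  assumes "M \<in> carrier_mat n n" "\<And>i j. i < n \<Longrightarrow> j < n \<Longrightarrow> M $$ (i, j) \<in> \<int>"
  shows "det M \<in> \<int>"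
  unfolding det_def'[OF assms(1)]
proof (intro Ints_sum Ints_mult Ints_prod)
  fix p i assume "p \<in> {p. p permutes {0..<n}}" "i \<in> {0..<n}"
  then show "M $$ (i, p i) \<in> \<int>"
    using permutes_in_image[of p "{0..<n}" i] by (intro assms(2)) auto
qed (auto simp: sign_def)

lemma abs_det_le:
  fixes M :: "real mat"
  assumes "M \<in> carrier_mat n n" "\<And>i j. i < n \<Longrightarrow> j < n \<Longrightarrow> \<bar>M $$ (i, j)\<bar> \<le> E"
  shows "\<bar>det M\<bar> \<le> fact n * E ^ n"
proof -
  have "\<bar>det M\<bar> \<le> (\<Sum>p\<in>{p. p permutes {0..<n}}. \<bar>signof p * (\<Prod>i = 0..<n. M $$ (i, p i))\<bar>)"
    unfolding det_def'[OF assms(1)] by (rule sum_abs)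
  also have "\<dots> \<le> (\<Sum>p\<in>{p. p permutes {0..<n}}. E ^ n)"
  proof (rule sum_mono)
    fix p assume "p \<in> {p. p permutes {0..<n}}"
    then have "(\<Prod>i = 0..<n. \<bar>M $$ (i, p i)\<bar>) \<le> (\<Prod>i = 0..<n. E)"
      using permutes_in_image[of p "{0..<n}"] by (intro prod_mono) (auto intro!: assms(2))
    then show "\<bar>signof p * (\<Prod>i = 0..<n. M $$ (i, p i))\<bar> \<le> E ^ n"
      by (simp add: abs_mult abs_prod sign_def)
  qed
  also have "\<dots> = fact n * E ^ n"
    by (simp add: card_permutations[OF refl])
  finally show ?thesis .
qed

text \<open>The exponent \<open>n\<close> instead of \<open>n - 1\<close>, and \<open>n^n\<close> instead of a factorial, keep the later estimates in terms of
  plain powers.\<close>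

lemma abs_adj_mat_le:
  fixes M :: "real mat"
  assumes M: "M \<in> carrier_mat n n" and E: "1 \<le> E" "\<And>i j. i < n \<Longrightarrow> j < n \<Longrightarrow> \<bar>M $$ (i, j)\<bar> \<le> E"
    and ij: "i < n" "j < n"
  shows "\<bar>adj_mat M $$ (i, j)\<bar> \<le> (real n * E) ^ n"
proof -
  have "\<bar>adj_mat M $$ (i, j)\<bar> = \<bar>det (mat_delete M j i)\<bar>"
    using M ij by (simp add: adj_mat_def cofactor_def abs_mult)
  also have "\<dots> \<le> fact (n - 1) * E ^ (n - 1)"
  proof (rule abs_det_le)
    show "mat_delete M j i \<in> carrier_mat (n - 1) (n - 1)"
      using M by (rule mat_delete_carrier)
    show "\<bar>mat_delete M j i $$ (k, l)\<bar> \<le> E" if "k < n - 1" "l < n - 1" for k l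
      using M that by (auto simp: mat_delete_def intro!: E(2))
  qed
  also have "\<dots> \<le> fact n * E ^ n"
    using E by (intro mult_mono fact_mono power_increasing) auto
  also have "\<dots> \<le> real n ^ n * E ^ n"
    using E fact_le_power[of n, where 'a = real] by (intro mult_right_mono) auto
  finally show ?thesis by (simp add: power_mult_distrib)
qed

text \<open>Cramer's rule: the entries of the adjugate are minors, which are bounded in terms of \<open>E\<close>. A nonzero determinant is at least
  \<open>1 / D^n\<close>, because \<open>D^n * det M\<close> is a nonzero integer.\<close>

lemma linear_system_solution_bound:
  fixes M :: "real mat"
  assumes M: "M \<in> carrier_mat n n" and det: "det M \<noteq> 0"
    and D: "D \<ge> 1" "\<And>i j. i < n \<Longrightarrow> j < n \<Longrightarrow> D * M $$ (i, j) \<in> \<int>"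
    and E: "1 \<le> E" "\<And>i j. i < n \<Longrightarrow> j < n \<Longrightarrow> \<bar>M $$ (i, j)\<bar> \<le> E"
    and y: "y \<in> carrier_vec n" "M *\<^sub>v y = b" and b: "\<And>j. j < n \<Longrightarrow> \<bar>b $ j\<bar> \<le> B"
    and i: "i < n"
  shows "\<bar>y $ i\<bar> \<le> real n * B * (D * (real n * E)) ^ n"
proof -
  have bn: "b \<in> carrier_vec n" using y M by auto
  have B: "0 \<le> B" using b[OF i] by linarith
  have "adj_mat M *\<^sub>v b = (adj_mat M * M) *\<^sub>v y"
    using adj_mat(1)[OF M] M y by (simp add: assoc_mult_mat_vec[of _ n n _ n])
  also have "\<dots> = det M \<cdot>\<^sub>v y"
    using y(1) unfolding adj_mat(3)[OF M] by (intro eq_vecI) auto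
  finally have sol: "adj_mat M *\<^sub>v b = det M \<cdot>\<^sub>v y" .
  have "\<bar>det M * y $ i\<bar> = \<bar>(adj_mat M *\<^sub>v b) $ i\<bar>"
    using sol i y by simp
  also have "\<dots> = \<bar>\<Sum>j = 0..<n. adj_mat M $$ (i, j) * b $ j\<bar>"
    using adj_mat(1)[OF M] bn i by (simp add: scalar_prod_def)
  also have "\<dots> \<le> (\<Sum>j = 0..<n. \<bar>adj_mat M $$ (i, j)\<bar> * \<bar>b $ j\<bar>)"
    by (rule order_trans[OF sum_abs]) (simp add: abs_mult)
  also have "\<dots> \<le> (\<Sum>j = 0..<n. (real n * E) ^ n * B)"
    using b E i by (intro sum_mono mult_mono abs_adj_mat_le[OF M E]) auto
  also have "\<dots> = real n * B * (real n * E) ^ n" by simp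
  finally have up: "\<bar>det M\<bar> * \<bar>y $ i\<bar> \<le> real n * B * (real n * E) ^ n" by (simp add: abs_mult)
  have "det (D \<cdot>\<^sub>m M) \<in> \<int>"
    using M D by (intro det_Ints[of _ n]) auto
  then have "D ^ n * det M \<in> \<int>" using M by simp
  moreover have "D ^ n * det M \<noteq> 0" using D det by simp
  ultimately have "1 \<le> \<bar>D ^ n * det M\<bar>" by (rule Ints_nonzero_abs_ge1)
  then have "1 \<le> D ^ n * \<bar>det M\<bar>" using D by (simp add: abs_mult)
  then have "1 * \<bar>y $ i\<bar> \<le> D ^ n * \<bar>det M\<bar> * \<bar>y $ i\<bar>" by (rule mult_right_mono) simp
  also have "\<dots> = D ^ n * (\<bar>det M\<bar> * \<bar>y $ i\<bar>)" by simp
  also have "\<dots> \<le> D ^ n * (real n * B * (real n * E) ^ n)"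
    using up D by (intro mult_left_mono) auto
  finally show ?thesis by (simp add: power_mult_distrib mult_ac)
qed

lemma linear_system_solvable:
  fixes M :: "real mat"
  assumes M: "M \<in> carrier_mat n n" and det: "det M \<noteq> 0" and b: "b \<in> carrier_vec n"
  obtains y where "y \<in> carrier_vec n" "M *\<^sub>v y = b"
proof -
  let ?Q = "(1 / det M) \<cdot>\<^sub>m adj_mat M"
  have Q: "?Q \<in> carrier_mat n n" "M * ?Q = 1\<^sub>m n"
    using adj_mat[OF M] M det by (auto simp: mult_smult_distrib[of _ n n _ n])
  have "M *\<^sub>v (?Q *\<^sub>v b) = (M * ?Q) *\<^sub>v b"
    using assoc_mult_mat_vec[OF M Q(1) b] by simp
  then have "M *\<^sub>v (?Q *\<^sub>v b) = b" unfolding Q(2) using b by simp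
  moreover have "?Q *\<^sub>v b \<in> carrier_vec n" using Q b by (meson mult_mat_vec_carrier)
  ultimately show ?thesis using that by blast
qed

section \<open>Decay of matrix powers\<close>

text \<open>For \<open>s\<close> strictly between the spectral radius and \<open>1\<close>, the matrix \<open>G / s\<close> still has spectral radius below \<open>1\<close>,
  so its powers are bounded.\<close>

lemma spectral_radius_powers_decay:
  assumes G: "G \<in> carrier_mat n n" and n: "n \<ge> 1" and sr: "real_spectral_radius G < 1"
  obtains s C where "0 < s" "s < 1" "0 \<le> C"
    "\<And>k i j. i < n \<Longrightarrow> j < n \<Longrightarrow> \<bar>(G ^\<^sub>m k) $$ (i, j)\<bar> \<le> C * s ^ k"
proof -
  let ?c = complex_of_real
  define CG where "CG = map_mat ?c G"
  have CG: "CG \<in> carrier_mat n n" using G by (simp add: CG_def)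
  obtain s where s: "max 0 (real_spectral_radius G) < s" "s < 1"
    using sr dense[of "max 0 (real_spectral_radius G)" 1] by auto
  define B where "B = ?c (1 / s) \<cdot>\<^sub>m CG"
  have B: "B \<in> carrier_mat n n" using CG by (simp add: B_def)
  have "spectral_radius B \<in> norm ` spectrum B"
    using spectral_radius_mem_max(1)[OF B] n by simp
  then obtain ev v where ev: "spectral_radius B = norm ev" "eigenvector B v ev"
    by (auto simp: spectrum_def eigenvalue_def)
  have v: "v \<in> carrier_vec n" "v \<noteq> 0\<^sub>v n" "B *\<^sub>v v = ev \<cdot>\<^sub>v v"
    using ev(2) B by (auto simp: eigenvector_def)
  have "CG *\<^sub>v v = ?c s \<cdot>\<^sub>v (B *\<^sub>v v)"
    using CG v(1) s(1) by (intro eq_vecI) (auto simp: B_def)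
  then have "eigenvector CG v (?c s * ev)"
    using v CG by (auto simp: eigenvector_def smult_smult_assoc)
  then have "norm (?c s * ev) \<in> norm ` spectrum CG"
    unfolding spectrum_def eigenvalue_def by blast
  then have "norm (?c s * ev) \<le> real_spectral_radius G"
    using spectral_radius_mem_max(2)[OF CG] n by (simp add: real_spectral_radius_def CG_def)
  moreover have "norm (?c s * ev) = s * norm ev" using s by (simp add: norm_mult)
  ultimately have "s * norm ev < s * 1" using s by linarith
  then have "spectral_radius B < 1" using s ev(1) by simp
  then obtain C where C: "\<And>k. norm_bound (B ^\<^sub>m k) C"
    using spectral_radius_jnf_norm_bound_less_1_upper_triangular[OF B] by blast
  have pow: "?c ((G ^\<^sub>m k) $$ (i, j)) = ?c s ^ k * (B ^\<^sub>m k) $$ (i, j)" if "i < n" "j < n" for i j k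
  proof -
    have CGB: "CG = ?c s \<cdot>\<^sub>m B" using s CG by (intro eq_matI) (auto simp: B_def)
    have "(?c s \<cdot>\<^sub>m B) ^\<^sub>m k = ?c s ^ k \<cdot>\<^sub>m B ^\<^sub>m k"
    proof (induction k)
      case 0
      then show ?case using B by (intro eq_matI) auto
    next
      case (Suc k)
      have "(?c s \<cdot>\<^sub>m B) ^\<^sub>m Suc k = (?c s ^ k \<cdot>\<^sub>m B ^\<^sub>m k) * (?c s \<cdot>\<^sub>m B)"
        using Suc by simp
      also have "\<dots> = ?c s \<cdot>\<^sub>m (?c s ^ k \<cdot>\<^sub>m (B ^\<^sub>m k * B))"
        using B by (simp add: mult_smult_distrib[of _ n n _ n] mult_smult_assoc_mat[of _ n n _ n])
      also have "\<dots> = ?c s ^ Suc k \<cdot>\<^sub>m B ^\<^sub>m Suc k"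
        using B by (intro eq_matI) (auto simp: mult_ac)
      finally show ?case .
    qed
    moreover have "map_mat ?c (G ^\<^sub>m k) = CG ^\<^sub>m k"
      unfolding CG_def by (rule of_real_hom.mat_hom_pow[OF G])
    ultimately have "map_mat ?c (G ^\<^sub>m k) = ?c s ^ k \<cdot>\<^sub>m B ^\<^sub>m k"
      by (simp add: CGB)
    from arg_cong[OF this, of "\<lambda>M. M $$ (i, j)"] show ?thesis
      using that G B by simp
  qed
  have "\<bar>(G ^\<^sub>m k) $$ (i, j)\<bar> \<le> C * s ^ k" if ij: "i < n" "j < n" for i j k
  proof -
    have "\<bar>(G ^\<^sub>m k) $$ (i, j)\<bar> = norm (?c s ^ k * (B ^\<^sub>m k) $$ (i, j))"
      unfolding pow[OF ij, symmetric] by simp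
    also have "\<dots> = s ^ k * norm ((B ^\<^sub>m k) $$ (i, j))"
      using s by (simp add: norm_mult norm_power)
    also have "\<dots> \<le> s ^ k * C"
      using C[of k] B ij s by (intro mult_left_mono) (auto simp: norm_bound_def)
    finally show ?thesis by (simp add: mult.commute)
  qed
  moreover have "0 \<le> C"
  proof -
    have "norm ((B ^\<^sub>m 0) $$ (0, 0)) \<le> C" using C[of 0, unfolded norm_bound_def, rule_format, of 0 0] B n by simp
    then show ?thesis by (rule order_trans[OF norm_ge_zero])
  qed
  ultimately show ?thesis using that[of s C] s by auto
qed

lemma bilinear_abs_le:
  fixes X :: "real mat"
  assumes X: "X \<in> carrier_mat n n" and u: "u \<in> carrier_vec n" "\<And>i. i < n \<Longrightarrow> \<bar>u $ i\<bar> \<le> a"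
    and w: "w \<in> carrier_vec n" "\<And>i. i < n \<Longrightarrow> \<bar>w $ i\<bar> \<le> b"
  shows "\<bar>u \<bullet> (X *\<^sub>v w)\<bar> \<le> a * b * (\<Sum>i<n. \<Sum>j<n. \<bar>X $$ (i, j)\<bar>)"
proof -
  have "u \<bullet> (X *\<^sub>v w) = (\<Sum>i<n. \<Sum>j<n. u $ i * X $$ (i, j) * w $ j)"
    using X u(1) w(1) by (simp add: scalar_prod_def atLeast0LessThan sum_distrib_left mult.assoc)
  also have "\<bar>\<dots>\<bar> \<le> (\<Sum>i<n. \<Sum>j<n. \<bar>u $ i * X $$ (i, j) * w $ j\<bar>)"
    by (rule order_trans[OF sum_abs]) (intro sum_mono sum_abs)
  also have "\<dots> \<le> (\<Sum>i<n. \<Sum>j<n. a * b * \<bar>X $$ (i, j)\<bar>)"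
  proof (intro sum_mono)
    fix i j assume "i \<in> {..<n}" "j \<in> {..<n}"
    then have "\<bar>u $ i\<bar> * \<bar>w $ j\<bar> * \<bar>X $$ (i, j)\<bar> \<le> a * b * \<bar>X $$ (i, j)\<bar>"
      using u(2)[of i] w(2)[of j] by (intro mult_right_mono mult_mono) auto
    then show "\<bar>u $ i * X $$ (i, j) * w $ j\<bar> \<le> a * b * \<bar>X $$ (i, j)\<bar>"
      by (simp add: abs_mult mult_ac)
  qed
  finally show ?thesis by (simp add: sum_distrib_left)
qed

lemma transpose_pow_Suc_mult_vec:
  fixes G :: "real mat"
  assumes "G \<in> carrier_mat n n" "u \<in> carrier_vec n"
  shows "(G ^\<^sub>m Suc k)\<^sup>T *\<^sub>v u = G\<^sup>T *\<^sub>v ((G ^\<^sub>m k)\<^sup>T *\<^sub>v u)"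
proof -
  have "(G ^\<^sub>m Suc k)\<^sup>T = G\<^sup>T * (G ^\<^sub>m k)\<^sup>T"
    using assms by (simp add: transpose_mult[of _ n n _ n])
  then show ?thesis using assms by (simp add: assoc_mult_mat_vec[of _ n n _ n])
qed

text \<open>This limit is the only way in which the spectral radius enters the analysis of the Lyapunov equation.\<close>

lemma dual_orbit_form_tendsto_0:
  assumes G: "G \<in> carrier_mat n n" and n: "n \<ge> 1" and sr: "real_spectral_radius G < 1"
    and X: "X \<in> carrier_mat n n" and u: "u \<in> carrier_vec n" and w: "w \<in> carrier_vec n"
  shows "(\<lambda>k. ((G ^\<^sub>m k)\<^sup>T *\<^sub>v u) \<bullet> (X *\<^sub>v ((G ^\<^sub>m k)\<^sup>T *\<^sub>v w))) \<longlonglongrightarrow> 0"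
proof -
  obtain s C where s: "0 < s" "s < 1" "0 \<le> C"
    and C: "\<And>k i j. i < n \<Longrightarrow> j < n \<Longrightarrow> \<bar>(G ^\<^sub>m k) $$ (i, j)\<bar> \<le> C * s ^ k"
    using spectral_radius_powers_decay[OF G n sr] by blast
  have orbit: "\<bar>((G ^\<^sub>m k)\<^sup>T *\<^sub>v z) $ i\<bar> \<le> C * (\<Sum>j<n. \<bar>z $ j\<bar>) * s ^ k"
    if "z \<in> carrier_vec n" "i < n" for z i k
  proof -
    have "((G ^\<^sub>m k)\<^sup>T *\<^sub>v z) $ i = (\<Sum>j<n. (G ^\<^sub>m k) $$ (j, i) * z $ j)"
      using that G by (simp add: scalar_prod_def atLeast0LessThan)
    also have "\<bar>\<dots>\<bar> \<le> (\<Sum>j<n. \<bar>(G ^\<^sub>m k) $$ (j, i)\<bar> * \<bar>z $ j\<bar>)"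
      by (rule order_trans[OF sum_abs]) (simp add: abs_mult)
    also have "\<dots> \<le> (\<Sum>j<n. C * s ^ k * \<bar>z $ j\<bar>)"
      using that C by (intro sum_mono mult_right_mono) auto
    finally show ?thesis by (simp add: sum_distrib_left mult_ac)
  qed
  define S where "S = (C * (\<Sum>j<n. \<bar>u $ j\<bar>)) * (C * (\<Sum>j<n. \<bar>w $ j\<bar>)) * (\<Sum>i<n. \<Sum>j<n. \<bar>X $$ (i, j)\<bar>)"
  have bound: "norm (((G ^\<^sub>m k)\<^sup>T *\<^sub>v u) \<bullet> (X *\<^sub>v ((G ^\<^sub>m k)\<^sup>T *\<^sub>v w))) \<le> S * (s * s) ^ k" for k
  proof -
    have "\<bar>((G ^\<^sub>m k)\<^sup>T *\<^sub>v u) \<bullet> (X *\<^sub>v ((G ^\<^sub>m k)\<^sup>T *\<^sub>v w))\<bar>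
      \<le> (C * (\<Sum>j<n. \<bar>u $ j\<bar>) * s ^ k) * (C * (\<Sum>j<n. \<bar>w $ j\<bar>) * s ^ k) * (\<Sum>i<n. \<Sum>j<n. \<bar>X $$ (i, j)\<bar>)"
      using G u w by (intro bilinear_abs_le[OF X] orbit mult_mat_vec_carrier[of _ n n]) auto
    then show ?thesis by (simp add: S_def power_mult_distrib mult_ac)
  qed
  have "s * s < 1" using s mult_strict_mono[of s 1 s 1] by simp
  then have "(\<lambda>k. S * (s * s) ^ k) \<longlonglongrightarrow> S * 0"
    using s by (intro tendsto_mult_left LIMSEQ_power_zero) auto
  then have lim: "(\<lambda>k. S * (s * s) ^ k) \<longlonglongrightarrow> 0" by simp
  show ?thesis
  proof (rule tendsto_0_le[OF lim, of _ 1], intro always_eventually allI)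
    fix k
    have "S * (s * s) ^ k \<le> norm (S * (s * s) ^ k)" by simp
    with bound[of k] show "norm (((G ^\<^sub>m k)\<^sup>T *\<^sub>v u) \<bullet> (X *\<^sub>v ((G ^\<^sub>m k)\<^sup>T *\<^sub>v w)))
        \<le> norm (S * (s * s) ^ k) * 1"
      by linarith
  qed
qed

section \<open>The Lyapunov equation\<close>

text \<open>The matrix of the operator \<open>X \<mapsto> X - G X G\<^sup>T\<close> on \<open>n \<times> n\<close> matrices, which are flattened row by row: the entry
  \<open>(i, j)\<close> is placed at position \<open>i * n + j\<close>.\<close>

definition lyapunov_mat :: "real mat \<Rightarrow> nat \<Rightarrow> real mat" where
  "lyapunov_mat G n = mat (n * n) (n * n) (\<lambda>(p, q).
     (if p = q then 1 else 0) - G $$ (p div n, q div n) * G $$ (p mod n, q mod n))"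

definition unflatten :: "nat \<Rightarrow> real vec \<Rightarrow> real mat" where
  "unflatten n y = mat n n (\<lambda>(i, j). y $ (i * n + j))"

lemma flat_index:
  assumes "i < n" "j < (n::nat)"
  shows "i * n + j < n * n" "(i * n + j) div n = i" "(i * n + j) mod n = j"
proof -
  have "i * n + j < i * n + n" using assms by simp
  also have "\<dots> = Suc i * n" by simp
  also have "\<dots> \<le> n * n" using assms by (intro mult_right_mono) auto
  finally show "i * n + j < n * n" .
qed (use assms in auto)

lemma flat_index_split:
  assumes "p < n * (n::nat)"
  shows "p div n < n" "p mod n < n" "p = p div n * n + p mod n"
  using assms by (auto simp: less_mult_imp_div_less) (cases n; simp)

lemma sum_flat_index:
  fixes g :: "nat \<Rightarrow> real"
  shows "(\<Sum>q<n * n. g q) = (\<Sum>i<n. \<Sum>j<n. g (i * n + j))"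
proof -
  have "(\<Sum>j<n. g (i * n + j)) = sum g {i * n..<i * n + n}" for i
    using sum.shift_bounds_nat_ivl[of g 0 "i * n" n] by (simp add: atLeast0LessThan add.commute)
  then show ?thesis by (simp add: sum.nat_group)
qed

lemma lyapunov_mat_mult_vec:
  assumes G: "G \<in> carrier_mat n n" and y: "y \<in> carrier_vec (n * n)" and ij: "i < n" "j < n"
  shows "(lyapunov_mat G n *\<^sub>v y) $ (i * n + j)
    = (unflatten n y - G * unflatten n y * G\<^sup>T) $$ (i, j)"
proof -
  let ?Y = "unflatten n y"
  have "(lyapunov_mat G n *\<^sub>v y) $ (i * n + j)
      = (\<Sum>q<n * n. (if i * n + j = q then y $ q else 0) - G $$ (i, q div n) * G $$ (j, q mod n) * y $ q)"
    using flat_index[OF ij] y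
    by (auto simp: lyapunov_mat_def scalar_prod_def atLeast0LessThan left_diff_distrib intro!: sum.cong)
  also have "\<dots> = y $ (i * n + j) - (\<Sum>q<n * n. G $$ (i, q div n) * G $$ (j, q mod n) * y $ q)"
    using flat_index[OF ij] by (simp add: sum_subtractf)
  also have "(\<Sum>q<n * n. G $$ (i, q div n) * G $$ (j, q mod n) * y $ q)
      = (\<Sum>k<n. \<Sum>l<n. G $$ (i, k) * G $$ (j, l) * ?Y $$ (k, l))"
    unfolding sum_flat_index by (intro sum.cong refl) (auto simp: unflatten_def)
  also have "\<dots> = (\<Sum>l<n. \<Sum>k<n. G $$ (i, k) * G $$ (j, l) * ?Y $$ (k, l))"
    by (rule sum.swap)
  also have "\<dots> = (\<Sum>l<n. (\<Sum>k<n. G $$ (i, k) * ?Y $$ (k, l)) * G $$ (j, l))"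
    by (simp add: sum_distrib_right sum_distrib_left mult_ac)
  also have "\<dots> = ((G * ?Y) * G\<^sup>T) $$ (i, j)"
    using G ij by (simp add: unflatten_def scalar_prod_def atLeast0LessThan del: assoc_mult_mat)
  finally show ?thesis using ij G by (simp add: unflatten_def del: assoc_mult_mat)
qed

text \<open>Such an \<open>X\<close> satisfies \<open>u \<bullet> X w = ((G\<^sup>T)^k u) \<bullet> X (G\<^sup>T)^k w\<close> for all \<open>k\<close>, and the right-hand side tends to \<open>0\<close>.\<close>

lemma lyapunov_homogeneous:
  assumes G: "G \<in> carrier_mat n n" and n: "n \<ge> 1" and sr: "real_spectral_radius G < 1"
    and X: "X \<in> carrier_mat n n" "X = G * X * G\<^sup>T"
  shows "X = 0\<^sub>m n n"
proof (rule eq_matI)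
  fix i j assume "i < dim_row (0\<^sub>m n n :: real mat)" "j < dim_col (0\<^sub>m n n :: real mat)"
  then have ij: "i < n" "j < n" by auto
  let ?p = "\<lambda>k z. (G ^\<^sub>m k)\<^sup>T *\<^sub>v z"
  let ?u = "unit_vec n i :: real vec" and ?w = "unit_vec n j :: real vec"
  have p: "?p k z \<in> carrier_vec n" if "z \<in> carrier_vec n" for k and z :: "real vec"
    using G that by (intro mult_mat_vec_carrier[of _ n n]) auto
  have step: "u \<bullet> (X *\<^sub>v w) = (G\<^sup>T *\<^sub>v u) \<bullet> (X *\<^sub>v (G\<^sup>T *\<^sub>v w))"
    if u: "u \<in> carrier_vec n" and w: "w \<in> carrier_vec n" for u w
  proof -
    have Xw: "X *\<^sub>v (G\<^sup>T *\<^sub>v w) \<in> carrier_vec n" using X G w by (intro mult_mat_vec_carrier[of _ n n]) auto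
    have "u \<bullet> (X *\<^sub>v w) = u \<bullet> ((G * X * G\<^sup>T) *\<^sub>v w)" using X(2) by simp
    also have "(G * X * G\<^sup>T) *\<^sub>v w = G *\<^sub>v (X *\<^sub>v (G\<^sup>T *\<^sub>v w))"
      using G X(1) w by (simp add: assoc_mult_mat_vec[of _ n n _ n])
    also have "u \<bullet> \<dots> = (G\<^sup>T *\<^sub>v u) \<bullet> (X *\<^sub>v (G\<^sup>T *\<^sub>v w))"
      by (rule transpose_vec_mult_scalar[OF G Xw u, symmetric])
    finally show ?thesis .
  qed
  have "(?p k ?u) \<bullet> (X *\<^sub>v (?p k ?w)) = ?u \<bullet> (X *\<^sub>v ?w)" for k
  proof (induction k)
    case (Suc k)
    then show ?case
      using step[OF p p, of ?u ?w k k] by (simp add: transpose_pow_Suc_mult_vec[OF G] del: pow_mat.simps)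
  qed (use G in simp)
  then have "?u \<bullet> (X *\<^sub>v ?w) = 0"
    using dual_orbit_form_tendsto_0[OF G n sr X(1), of ?u ?w] LIMSEQ_unique[OF _ tendsto_const] by force
  then show "X $$ (i, j) = 0\<^sub>m n n $$ (i, j)"
    using X(1) ij by (simp add: scalar_prod_left_unit[of _ n])
qed (use X in auto)

lemma det_lyapunov_mat_nonzero:
  assumes G: "G \<in> carrier_mat n n" and n: "n \<ge> 1" and sr: "real_spectral_radius G < 1"
  shows "det (lyapunov_mat G n) \<noteq> 0"
proof
  assume "det (lyapunov_mat G n) = 0"
  moreover have L: "lyapunov_mat G n \<in> carrier_mat (n * n) (n * n)" by (simp add: lyapunov_mat_def)
  ultimately obtain y where y: "y \<in> carrier_vec (n * n)" "y \<noteq> 0\<^sub>v (n * n)"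
    "lyapunov_mat G n *\<^sub>v y = 0\<^sub>v (n * n)"
    using det_0_iff_vec_prod_zero[OF L] by auto
  have Y: "unflatten n y \<in> carrier_mat n n" by (simp add: unflatten_def)
  have GYG: "G * unflatten n y * G\<^sup>T \<in> carrier_mat n n"
    using G Y by (meson mult_carrier_mat transpose_carrier_mat)
  have "unflatten n y = G * unflatten n y * G\<^sup>T"
  proof (rule eq_matI)
    fix i j assume "i < dim_row (G * unflatten n y * G\<^sup>T)" "j < dim_col (G * unflatten n y * G\<^sup>T)"
    then have ij: "i < n" "j < n" using GYG by auto
    have "(unflatten n y - G * unflatten n y * G\<^sup>T) $$ (i, j) = 0"
      using lyapunov_mat_mult_vec[OF G y(1) ij] y(3) flat_index[OF ij] by simp
    then show "unflatten n y $$ (i, j) = (G * unflatten n y * G\<^sup>T) $$ (i, j)"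
      using G GYG ij by (simp del: assoc_mult_mat)
  qed (use GYG Y in auto)
  then have zero: "unflatten n y = 0\<^sub>m n n" by (rule lyapunov_homogeneous[OF G n sr Y])
  have "y $ p = 0" if "p < n * n" for p
  proof -
    have "unflatten n y $$ (p div n, p mod n) = y $ p"
      using flat_index_split[OF that] by (simp add: unflatten_def)
    then show ?thesis using zero flat_index_split[OF that] by simp
  qed
  then have "y = 0\<^sub>v (n * n)" using y(1) by (intro eq_vecI) auto
  with y(2) show False by simp
qed

text \<open>The operator is injective, hence the equation is solvable. The solution is symmetric
  because its transpose solves the same equation.\<close>

lemma lyapunov_solution_exists:
  assumes G: "G \<in> carrier_mat n n" and n: "n \<ge> 1" and sr: "real_spectral_radius G < 1"
  obtains Y where "Y \<in> carrier_mat n n" "sym_mat Y" "Y - G * Y * G\<^sup>T = 1\<^sub>m n"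
proof -
  let ?L = "lyapunov_mat G n"
  have L: "?L \<in> carrier_mat (n * n) (n * n)" by (simp add: lyapunov_mat_def)
  define b :: "real vec" where "b = vec (n * n) (\<lambda>p. if p div n = p mod n then 1 else 0)"
  have b: "b \<in> carrier_vec (n * n)" by (simp add: b_def)
  obtain y where y: "y \<in> carrier_vec (n * n)" "?L *\<^sub>v y = b"
    using linear_system_solvable[OF L det_lyapunov_mat_nonzero[OF assms] b] by blast
  define Y where "Y = unflatten n y"
  have Y: "Y \<in> carrier_mat n n" by (simp add: Y_def unflatten_def)
  have GYG: "G * Y * G\<^sup>T \<in> carrier_mat n n"
    using G Y by (meson mult_carrier_mat transpose_carrier_mat)
  have eq: "Y - G * Y * G\<^sup>T = 1\<^sub>m n"
  proof (rule eq_matI)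
    fix i j assume "i < dim_row (1\<^sub>m n :: real mat)" "j < dim_col (1\<^sub>m n :: real mat)"
    then have ij: "i < n" "j < n" by auto
    show "(Y - G * Y * G\<^sup>T) $$ (i, j) = 1\<^sub>m n $$ (i, j)"
      using lyapunov_mat_mult_vec[OF G y(1) ij] y(2) flat_index[OF ij] ij by (simp add: Y_def b_def)
  qed (use Y GYG in auto)
  have sum: "Y = 1\<^sub>m n + G * Y * G\<^sup>T"
  proof -
    have "Y = (Y - G * Y * G\<^sup>T) + G * Y * G\<^sup>T" using Y GYG by (intro eq_matI) auto
    then show ?thesis unfolding eq .
  qed
  have "(G * Y * G\<^sup>T)\<^sup>T = G * Y\<^sup>T * G\<^sup>T"
    using G Y by (simp add: transpose_mult[of _ n n _ n])
  then have sumT: "Y\<^sup>T = 1\<^sub>m n + G * Y\<^sup>T * G\<^sup>T"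
    using arg_cong[OF sum, of transpose_mat] GYG by (simp add: transpose_add[of _ n n])
  have "Y - Y\<^sup>T = 0\<^sub>m n n"
  proof (rule lyapunov_homogeneous[OF assms])
    have GYTG: "G * Y\<^sup>T * G\<^sup>T \<in> carrier_mat n n"
      using G Y by (meson mult_carrier_mat transpose_carrier_mat)
    have "G * (Y - Y\<^sup>T) * G\<^sup>T = G * Y * G\<^sup>T - G * Y\<^sup>T * G\<^sup>T"
      using G Y
      by (simp add: mult_minus_distrib_mat[of _ n n _ n] minus_mult_distrib_mat[of _ n n _ _ n] del: assoc_mult_mat)
    also have "\<dots> = (1\<^sub>m n + G * Y * G\<^sup>T) - (1\<^sub>m n + G * Y\<^sup>T * G\<^sup>T)"
      using GYG GYTG by (intro eq_matI) auto
    finally show "Y - Y\<^sup>T = G * (Y - Y\<^sup>T) * G\<^sup>T" using sum sumT by simp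
  qed (use Y in auto)
  then have zero: "(Y - Y\<^sup>T) $$ (j, i) = 0" if "i < n" "j < n" for i j using that by simp
  have "Y\<^sup>T = Y"
  proof (rule eq_matI)
    fix i j assume "i < dim_row Y" "j < dim_col Y"
    then have "i < n" "j < n" using Y by auto
    then show "Y\<^sup>T $$ (i, j) = Y $$ (i, j)" using Y zero[of i j] by simp
  qed (use Y in auto)
  then have sym: "sym_mat Y" using Y by (auto simp: sym_mat_def)
  show ?thesis by (rule that[OF Y sym eq])
qed

text \<open>If \<open>D\<close> clears the denominators of \<open>G\<close>, then \<open>D\<^sup>2\<close> clears those of the operator, whose entries are at most
  \<open>1 + g\<^sup>2 \<le> 2 * g\<^sup>2\<close>.\<close>

lemma lyapunov_solution_bound:
  assumes G: "G \<in> carrier_mat n n" and n: "n \<ge> 1" and sr: "real_spectral_radius G < 1"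
    and Y: "Y \<in> carrier_mat n n" "Y - G * Y * G\<^sup>T = 1\<^sub>m n"
    and D: "1 \<le> D" "\<And>i j. i < n \<Longrightarrow> j < n \<Longrightarrow> D * G $$ (i, j) \<in> \<int>" "D \<in> \<int>"
    and g: "1 \<le> g" "\<And>i j. i < n \<Longrightarrow> j < n \<Longrightarrow> \<bar>G $$ (i, j)\<bar> \<le> g" and ij: "i < n" "j < n"
  shows "\<bar>Y $$ (i, j)\<bar> \<le> real (n * n) * (D\<^sup>2 * (real (n * n) * (2 * g\<^sup>2))) ^ (n * n)"
proof -
  let ?L = "lyapunov_mat G n"
  have L: "?L \<in> carrier_mat (n * n) (n * n)" by (simp add: lyapunov_mat_def)
  define y where "y = vec (n * n) (\<lambda>p. Y $$ (p div n, p mod n))"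
  have y: "y \<in> carrier_vec (n * n)" by (simp add: y_def)
  have unfl: "unflatten n y = Y"
    using Y(1) flat_index by (intro eq_matI) (auto simp: unflatten_def y_def)
  have rhs: "\<bar>(?L *\<^sub>v y) $ p\<bar> \<le> 1" if p: "p < n * n" for p
  proof -
    note idx = flat_index_split[OF p]
    have "(?L *\<^sub>v y) $ p = (1\<^sub>m n :: real mat) $$ (p div n, p mod n)"
      using lyapunov_mat_mult_vec[OF G y idx(1,2)] idx(3) unfl Y(2) by simp
    then show ?thesis using idx by simp
  qed
  have "\<bar>y $ (i * n + j)\<bar> \<le> real (n * n) * 1 * (D\<^sup>2 * (real (n * n) * (2 * g\<^sup>2))) ^ (n * n)"
  proof (rule linear_system_solution_bound[OF L det_lyapunov_mat_nonzero[OF G n sr] _ _ _ _ y refl rhs])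
    show "1 \<le> D\<^sup>2" using D(1) by simp
    have g2: "1 \<le> g\<^sup>2" using g(1) by simp
    then show "1 \<le> 2 * g\<^sup>2" by simp
    fix p q assume pq: "p < n * n" "q < n * n"
    note idx = flat_index_split[OF pq(1)] flat_index_split[OF pq(2)]
    have "D\<^sup>2 * ?L $$ (p, q) = (if p = q then D * D else 0)
        - (D * G $$ (p div n, q div n)) * (D * G $$ (p mod n, q mod n))"
      using pq by (simp add: lyapunov_mat_def power2_eq_square algebra_simps)
    also have "\<dots> \<in> \<int>"
    proof (rule Ints_diff)
      show "(if p = q then D * D else 0) \<in> \<int>" using D(3) by (auto intro: Ints_mult)
      show "(D * G $$ (p div n, q div n)) * (D * G $$ (p mod n, q mod n)) \<in> \<int>"
        using idx by (intro Ints_mult[OF D(2) D(2)])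
    qed
    finally show "D\<^sup>2 * ?L $$ (p, q) \<in> \<int>" .
    have "\<bar>G $$ (p div n, q div n) * G $$ (p mod n, q mod n)\<bar> \<le> g * g"
      unfolding abs_mult using idx g by (intro mult_mono) auto
    then have "\<bar>G $$ (p div n, q div n) * G $$ (p mod n, q mod n)\<bar> \<le> g\<^sup>2"
      by (simp add: power2_eq_square)
    then show "\<bar>?L $$ (p, q)\<bar> \<le> 2 * g\<^sup>2"
      using pq g2 abs_triangle_ineq4[of "if p = q then 1 else 0" "G $$ (p div n, q div n) * G $$ (p mod n, q mod n)"]
      by (auto simp: lyapunov_mat_def split: if_splits)
  next
    show "i * n + j < n * n" using flat_index[OF ij] by simp
  qed
  then show ?thesis using ij flat_index[OF ij] by (simp add: y_def)
qed

lemma lyapunov_dual_step: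
  fixes G Y :: "real mat"
  assumes G: "G \<in> carrier_mat n n" and Y: "Y \<in> carrier_mat n n" "Y - G * Y * G\<^sup>T = 1\<^sub>m n"
    and w: "w \<in> carrier_vec n"
  shows "(G\<^sup>T *\<^sub>v w) \<bullet> (Y *\<^sub>v (G\<^sup>T *\<^sub>v w)) = w \<bullet> (Y *\<^sub>v w) - w \<bullet> w"
proof -
  have GYG: "G * Y * G\<^sup>T \<in> carrier_mat n n"
    using G Y by (meson mult_carrier_mat transpose_carrier_mat)
  have "w \<bullet> ((Y - G * Y * G\<^sup>T) *\<^sub>v w) = w \<bullet> (Y *\<^sub>v w) - w \<bullet> ((G * Y * G\<^sup>T) *\<^sub>v w)"
    unfolding minus_mult_distrib_mat_vec[OF Y(1) GYG w]
    by (rule scalar_prod_minus_distrib[OF w mult_mat_vec_carrier[OF Y(1) w] mult_mat_vec_carrier[OF GYG w]])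
  moreover have "w \<bullet> ((G * Y * G\<^sup>T) *\<^sub>v w) = (G\<^sup>T *\<^sub>v w) \<bullet> (Y *\<^sub>v (G\<^sup>T *\<^sub>v w))"
    using congruence_quad_form[of Y n "G\<^sup>T" w] G Y w by (simp del: assoc_mult_mat)
  ultimately show ?thesis using Y(2) w by simp
qed

text \<open>By the Lyapunov equation, \<open>w \<bullet> Y w - w \<bullet> w\<close> is the value of the form \<open>Y\<close> after one dual step. Along the dual
  orbit the values of this form do not increase and tend to \<open>0\<close>, so they are nonnegative.\<close>

lemma lyapunov_ge_identity:
  assumes G: "G \<in> carrier_mat n n" and n: "n \<ge> 1" and sr: "real_spectral_radius G < 1"
    and Y: "Y \<in> carrier_mat n n" "Y - G * Y * G\<^sup>T = 1\<^sub>m n" and w: "w \<in> carrier_vec n"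
  shows "w \<bullet> w \<le> w \<bullet> (Y *\<^sub>v w)"
proof -
  let ?p = "\<lambda>k. (G ^\<^sub>m k)\<^sup>T *\<^sub>v w"
  let ?q = "\<lambda>k. ?p k \<bullet> (Y *\<^sub>v ?p k)"
  have p: "?p k \<in> carrier_vec n" for k
    using G w by (intro mult_mat_vec_carrier[of _ n n]) auto
  have "?q (Suc k) = ?q k - ?p k \<bullet> ?p k" for k
    using lyapunov_dual_step[OF G Y p[of k]] transpose_pow_Suc_mult_vec[OF G w, of k] by simp
  moreover have "0 \<le> ?p k \<bullet> ?p k" for k by (simp add: scalar_prod_def sum_nonneg)
  ultimately have "decseq ?q" by (intro decseq_SucI) simp
  then have "0 \<le> ?q 1"
    by (rule decseq_ge[OF _ dual_orbit_form_tendsto_0[OF G n sr Y(1) w w]])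
  moreover have "?q 1 = w \<bullet> (Y *\<^sub>v w) - w \<bullet> w"
    using lyapunov_dual_step[OF G Y w] G by simp
  ultimately show ?thesis by simp
qed

text \<open>A dual step lowers the form \<open>Y\<close> by \<open>w \<bullet> w\<close>, which is at least \<open>(w \<bullet> Y w) / lam\<close>.\<close>

lemma lyapunov_dual_contraction:
  assumes G: "G \<in> carrier_mat n n" and n: "n \<ge> 1" and sr: "real_spectral_radius G < 1"
    and Y: "Y \<in> carrier_mat n n" "Y - G * Y * G\<^sup>T = 1\<^sub>m n"
    and lam: "1 \<le> lam" "\<And>v. v \<in> carrier_vec n \<Longrightarrow> v \<bullet> (Y *\<^sub>v v) \<le> lam * (v \<bullet> v)"
    and w: "w \<in> carrier_vec n"
  shows "((G ^\<^sub>m k)\<^sup>T *\<^sub>v w) \<bullet> ((G ^\<^sub>m k)\<^sup>T *\<^sub>v w) \<le> (1 - 1 / lam) ^ k * (w \<bullet> (Y *\<^sub>v w))"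
proof -
  let ?p = "\<lambda>k. (G ^\<^sub>m k)\<^sup>T *\<^sub>v w"
  let ?q = "\<lambda>k. ?p k \<bullet> (Y *\<^sub>v ?p k)"
  have p: "?p k \<in> carrier_vec n" for k
    using G w by (intro mult_mat_vec_carrier[of _ n n]) auto
  have "?q k \<le> (1 - 1 / lam) ^ k * (w \<bullet> (Y *\<^sub>v w))"
  proof (induction k)
    case 0
    then show ?case using G w by simp
  next
    case (Suc k)
    have "?q (Suc k) = ?q k - ?p k \<bullet> ?p k"
      using lyapunov_dual_step[OF G Y p[of k]] transpose_pow_Suc_mult_vec[OF G w, of k] by simp
    also have "\<dots> \<le> ?q k - ?q k / lam"
      using lam(1) lam(2)[OF p[of k]] by (simp add: field_simps)
    also have "\<dots> = (1 - 1 / lam) * ?q k" by (simp add: algebra_simps)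
    also have "\<dots> \<le> (1 - 1 / lam) * ((1 - 1 / lam) ^ k * (w \<bullet> (Y *\<^sub>v w)))"
      using Suc lam(1) by (intro mult_left_mono) auto
    finally show ?case by simp
  qed
  with lyapunov_ge_identity[OF G n sr Y p[of k]] show ?thesis by linarith
qed

section \<open>Vertices of bounded polyhedra\<close>

definition tight_rows :: "real mat \<Rightarrow> real vec \<Rightarrow> nat set" where
  "tight_rows A x = {i. i < dim_row A \<and> row A i \<bullet> x = 1}"

text \<open>The tight rows span the whole space. This is the algebraic description of an extreme point, and
  the form in which Cramer's rule applies.\<close>

definition is_vertex :: "real mat \<Rightarrow> real vec \<Rightarrow> bool" where
  "is_vertex A x \<longleftrightarrow> x \<in> polyhedron_le_one A \<and>
     (\<forall>z \<in> carrier_vec (dim_col A). (\<forall>i \<in> tight_rows A x. row A i \<bullet> z = 0) \<longrightarrow> z = 0\<^sub>v (dim_col A))"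

lemma polyhedron_le_one_iff:
  assumes "A \<in> carrier_mat m n"
  shows "x \<in> polyhedron_le_one A \<longleftrightarrow> x \<in> carrier_vec n \<and> (\<forall>i<m. row A i \<bullet> x \<le> 1)"
  using assms mult_le_ones_iff[OF assms] by (auto simp: polyhedron_le_one_def)

text \<open>Otherwise the polyhedron, which contains the origin, would contain the whole ray spanned by \<open>z\<close>.\<close>

lemma bounded_polyhedron_no_recession:
  assumes A: "A \<in> carrier_mat m n" and bdd: "bounded_vecs (polyhedron_le_one A)"
    and z: "z \<in> carrier_vec n" "z \<noteq> 0\<^sub>v n"
  shows "\<exists>i<m. row A i \<bullet> z > 0"
proof (rule ccontr)
  assume "\<not> ?thesis"
  then have neg: "row A i \<bullet> z \<le> 0" if "i < m" for i using that by force
  obtain B where B: "\<And>x. x \<in> polyhedron_le_one A \<Longrightarrow> sqrt (x \<bullet> x) \<le> B"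
    using bdd by (auto simp: bounded_vecs_def)
  have pos: "0 < z \<bullet> z" by (rule scalar_prod_self_pos[OF z])
  \<comment> \<open>The factor that gives \<open>t z\<close> the norm \<open>\<bar>B\<bar> + 1\<close>.\<close>
  define t where "t = (\<bar>B\<bar> + 1) / sqrt (z \<bullet> z)"
  have t: "0 \<le> t" using pos by (simp add: t_def)
  have "row A i \<bullet> (t \<cdot>\<^sub>v z) \<le> 1" if "i < m" for i
  proof -
    have "row A i \<bullet> (t \<cdot>\<^sub>v z) = t * (row A i \<bullet> z)"
      using A z that by (intro scalar_prod_smult_distrib[of _ n]) auto
    also have "\<dots> \<le> 0" using t neg[OF that] by (rule mult_nonneg_nonpos)
    finally show ?thesis by simp
  qed
  then have "t \<cdot>\<^sub>v z \<in> polyhedron_le_one A"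
    using z by (simp add: polyhedron_le_one_iff[OF A])
  from B[OF this] have "sqrt (t * t * (z \<bullet> z)) \<le> B" using z by (simp add: mult.assoc)
  then have "t * sqrt (z \<bullet> z) \<le> B" using t by (simp add: real_sqrt_mult)
  then show False using pos by (simp add: t_def)
qed

text \<open>As long as some direction is orthogonal to all tight rows, moving along it does not decrease the objective
  if its sign is chosen well. Because the polyhedron is bounded, another row becomes tight on the way. The
  number of rows that are not tight decreases strictly.\<close>

lemma exists_better_vertex:
  assumes A: "A \<in> carrier_mat m n" and bdd: "bounded_vecs (polyhedron_le_one A)"
    and e: "e \<in> carrier_vec n" and x: "x \<in> polyhedron_le_one A"
  shows "\<exists>x'. is_vertex A x' \<and> e \<bullet> x \<le> e \<bullet> x'"
  using x
proof (induction "m - card (tight_rows A x)" arbitrary: x rule: less_induct)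
  case less
  have xn: "x \<in> carrier_vec n" and xle: "\<And>i. i < m \<Longrightarrow> row A i \<bullet> x \<le> 1"
    using less.prems by (auto simp: polyhedron_le_one_iff[OF A])
  have rows: "row A i \<in> carrier_vec n" if "i < m" for i using A that by auto
  show ?case
  proof (cases "is_vertex A x")
    case False
    then obtain z0 where z0: "z0 \<in> carrier_vec n" "\<And>i. i \<in> tight_rows A x \<Longrightarrow> row A i \<bullet> z0 = 0" "z0 \<noteq> 0\<^sub>v n"
      using less.prems A by (auto simp: is_vertex_def)
    define z where "z = (if e \<bullet> z0 \<ge> 0 then z0 else (- 1) \<cdot>\<^sub>v z0)"
    have z: "z \<in> carrier_vec n" using z0 by (simp add: z_def)
    have ez: "0 \<le> e \<bullet> z"
      using z0 e by (simp add: z_def)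
    have zt: "row A i \<bullet> z = 0" if "i \<in> tight_rows A x" for i
      using z0(1) z0(2)[OF that] rows[of i] that A by (simp add: z_def tight_rows_def)
    have znz: "z \<noteq> 0\<^sub>v n"
    proof -
      have "z \<bullet> z = z0 \<bullet> z0" using z0(1) by (simp add: z_def)
      then have "0 < z \<bullet> z" using scalar_prod_self_pos[OF z0(1,3)] by simp
      then show ?thesis by auto
    qed
    \<comment> \<open>Only rows in \<open>S\<close> can become violated. The first of them to become tight determines the step length \<open>t\<close>.\<close>
    define S where "S = {i. i < m \<and> row A i \<bullet> z > 0}"
    have S: "finite S" "S \<noteq> {}"
      using bounded_polyhedron_no_recession[OF A bdd z znz] by (auto simp: S_def)
    define f where "f = (\<lambda>i. (1 - row A i \<bullet> x) / (row A i \<bullet> z))"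
    define t where "t = Min (f ` S)"
    have "t \<in> f ` S" unfolding t_def using S by (intro Min_in) auto
    then obtain i0 where i0: "i0 \<in> S" "t = f i0" by auto
    have t0: "0 \<le> t" using i0 xle[of i0] by (simp add: f_def S_def)
    have tle: "t \<le> f i" if "i \<in> S" for i using S that by (simp add: t_def)
    define x1 where "x1 = x + t \<cdot>\<^sub>v z"
    have x1n: "x1 \<in> carrier_vec n" using xn z by (simp add: x1_def)
    have lin: "v \<bullet> x1 = v \<bullet> x + t * (v \<bullet> z)" if "v \<in> carrier_vec n" for v
      using that xn z by (simp add: x1_def scalar_prod_add_distrib[of _ n])
    have "row A i \<bullet> x1 \<le> 1" if i: "i < m" for i
    proof (cases "i \<in> S")
      case True
      then have "t * (row A i \<bullet> z) \<le> 1 - row A i \<bullet> x"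
        using tle[OF True] by (simp add: f_def S_def pos_le_divide_eq)
      then show ?thesis using lin[OF rows[OF i]] by simp
    next
      case False
      then have "t * (row A i \<bullet> z) \<le> 0"
        using t0 i by (intro mult_nonneg_nonpos) (auto simp: S_def)
      then show ?thesis using lin[OF rows[OF i]] xle[OF i] by simp
    qed
    then have x1P: "x1 \<in> polyhedron_le_one A"
      using x1n by (simp add: polyhedron_le_one_iff[OF A])
    have "tight_rows A x \<subseteq> tight_rows A x1"
      using zt lin[OF rows] A by (auto simp: tight_rows_def)
    moreover have "i0 \<in> tight_rows A x1"
      using i0 lin[OF rows[of i0]] A by (simp add: tight_rows_def S_def f_def)
    moreover have "i0 \<notin> tight_rows A x"
      using zt[of i0] i0 by (auto simp: S_def)
    ultimately have "tight_rows A x \<subset> tight_rows A x1" by auto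
    moreover have "tight_rows A x1 \<subseteq> {..<m}" using A by (auto simp: tight_rows_def)
    ultimately have "card (tight_rows A x) < card (tight_rows A x1)" "card (tight_rows A x1) \<le> m"
      using finite_subset[of "tight_rows A x1" "{..<m}"] card_mono[of "{..<m}" "tight_rows A x1"]
      by (auto intro: psubset_card_mono)
    then have "m - card (tight_rows A x1) < m - card (tight_rows A x)" by linarith
    from less.hyps[OF this x1P] obtain x' where "is_vertex A x'" "e \<bullet> x1 \<le> e \<bullet> x'" by blast
    moreover have "e \<bullet> x \<le> e \<bullet> x1" using lin[OF e] t0 ez by simp
    ultimately show ?thesis by (auto intro: order_trans)
  qed auto
qed

text \<open>The tight rows may be more than \<open>n\<close>. Instead of selecting a basis among them, the proof uses the
  normal equations \<open>B\<^sup>T B x = B\<^sup>T b\<close> of the system formed by all of them, whose matrix is square and nonsingular.\<close>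

lemma vertex_coordinate_bound:
  assumes A: "A \<in> carrier_mat m n" and m: "m \<ge> 1" and x: "is_vertex A x"
    and D: "1 \<le> D" "\<And>i j. i < m \<Longrightarrow> j < n \<Longrightarrow> D * A $$ (i, j) \<in> \<int>"
    and g: "1 \<le> g" "\<And>i j. i < m \<Longrightarrow> j < n \<Longrightarrow> \<bar>A $$ (i, j)\<bar> \<le> g" and j: "j < n"
  shows "\<bar>x $ j\<bar> \<le> real n * (real m * g) * (D\<^sup>2 * (real n * (real m * g\<^sup>2))) ^ n"
proof -
  define T where "T = tight_rows A x"
  \<comment> \<open>Rows that are not tight are replaced by zero rows, which do not contribute to \<open>B\<^sup>T B\<close>.\<close>
  define B where "B = mat m n (\<lambda>(i, j). if i \<in> T then A $$ (i, j) else 0)"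
  have B: "B \<in> carrier_mat m n" by (simp add: B_def)
  have BT: "B\<^sup>T * B \<in> carrier_mat n n" using B by (meson mult_carrier_mat transpose_carrier_mat)
  have xn: "x \<in> carrier_vec n" using x A by (auto simp: is_vertex_def polyhedron_le_one_def)
  have Bz: "(B *\<^sub>v z) $ i = (if i \<in> T then row A i \<bullet> z else 0)" if "i < m" "z \<in> carrier_vec n" for i z
    using that A by (auto simp: B_def scalar_prod_def intro!: sum.neutral)
  have spans: "z = 0\<^sub>v n" if "z \<in> carrier_vec n" "B *\<^sub>v z = 0\<^sub>v m" for z
  proof -
    have "row A i \<bullet> z = 0" if "i \<in> T" for i
      using Bz[of i z] that \<open>z \<in> carrier_vec n\<close> \<open>B *\<^sub>v z = 0\<^sub>v m\<close> A by (auto simp: T_def tight_rows_def)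
    then show ?thesis using x A that(1) by (auto simp: is_vertex_def T_def)
  qed
  have det: "det (B\<^sup>T * B) \<noteq> 0"
  proof
    assume "det (B\<^sup>T * B) = 0"
    then obtain z where z: "z \<in> carrier_vec n" "z \<noteq> 0\<^sub>v n" "(B\<^sup>T * B) *\<^sub>v z = 0\<^sub>v n"
      using det_0_iff_vec_prod_zero[OF BT] by auto
    have Bzc: "B *\<^sub>v z \<in> carrier_vec m" using B z by simp
    have "(B *\<^sub>v z) \<bullet> (B *\<^sub>v z) = (B\<^sup>T *\<^sub>v (B *\<^sub>v z)) \<bullet> z"
      by (rule transpose_vec_mult_scalar[OF B z(1) Bzc, symmetric])
    also have "B\<^sup>T *\<^sub>v (B *\<^sub>v z) = 0\<^sub>v n"
      using z B by (simp add: assoc_mult_mat_vec[of _ n m _ n])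
    finally have "\<not> (B *\<^sub>v z) \<bullet> (B *\<^sub>v z) > 0" using z by simp
    then have "B *\<^sub>v z = 0\<^sub>v m" using scalar_prod_self_pos[OF Bzc] by blast
    then show False using spans z by blast
  qed
  define b where "b = B\<^sup>T *\<^sub>v (B *\<^sub>v x)"
  have Mx: "(B\<^sup>T * B) *\<^sub>v x = b"
    unfolding b_def using B xn by (intro assoc_mult_mat_vec[of _ n m _ n]) auto
  have Babs: "\<bar>B $$ (k, i)\<bar> \<le> g" if "k < m" "i < n" for k i
    using that g A by (auto simp: B_def T_def tight_rows_def)
  have Bint: "D * B $$ (k, i) \<in> \<int>" if "k < m" "i < n" for k i
    using that D A by (auto simp: B_def T_def tight_rows_def)
  have ent: "(B\<^sup>T * B) $$ (i, k) = (\<Sum>l<m. B $$ (l, i) * B $$ (l, k))" if "i < n" "k < n" for i k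
    using that B by (simp add: scalar_prod_def atLeast0LessThan)
  show ?thesis
  proof (rule linear_system_solution_bound[OF BT det _ _ _ _ xn Mx _ j])
    show "1 \<le> D\<^sup>2" using D by simp
    have "1 * 1 \<le> real m * g\<^sup>2" using m g(1) by (intro mult_mono) auto
    then show "1 \<le> real m * g\<^sup>2" by simp
    fix i k assume ik: "i < n" "k < n"
    have "D\<^sup>2 * (B\<^sup>T * B) $$ (i, k) = (\<Sum>l<m. (D * B $$ (l, i)) * (D * B $$ (l, k)))"
      unfolding ent[OF ik] by (simp add: sum_distrib_left power2_eq_square mult_ac)
    also have "\<dots> \<in> \<int>" using ik by (intro Ints_sum Ints_mult Bint) auto
    finally show "D\<^sup>2 * (B\<^sup>T * B) $$ (i, k) \<in> \<int>" .
    have "\<bar>(B\<^sup>T * B) $$ (i, k)\<bar> \<le> (\<Sum>l<m. \<bar>B $$ (l, i)\<bar> * \<bar>B $$ (l, k)\<bar>)"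
      unfolding ent[OF ik] by (rule order_trans[OF sum_abs]) (simp add: abs_mult)
    also have "\<dots> \<le> (\<Sum>l<m. g * g)"
      using ik g by (intro sum_mono mult_mono Babs) auto
    finally show "\<bar>(B\<^sup>T * B) $$ (i, k)\<bar> \<le> real m * g\<^sup>2" by (simp add: power2_eq_square)
  next
    fix i assume i: "i < n"
    have Bx: "\<bar>(B *\<^sub>v x) $ l\<bar> \<le> 1" if "l < m" for l
      unfolding Bz[OF that xn] by (simp add: T_def tight_rows_def)
    have "b $ i = (\<Sum>l<m. B $$ (l, i) * (B *\<^sub>v x) $ l)"
      using i B unfolding b_def by (simp add: scalar_prod_def[of "col _ _"] atLeast0LessThan)
    also have "\<bar>\<dots>\<bar> \<le> (\<Sum>l<m. \<bar>B $$ (l, i)\<bar> * \<bar>(B *\<^sub>v x) $ l\<bar>)"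
      by (rule order_trans[OF sum_abs]) (simp add: abs_mult)
    also have "\<dots> \<le> (\<Sum>l<m. g * 1)"
      using i g Bx by (intro sum_mono mult_mono Babs) auto
    finally show "\<bar>b $ i\<bar> \<le> real m * g" by simp
  qed
qed

text \<open>Vertices maximize and minimize the coordinate \<open>j\<close>.\<close>

lemma polyhedron_coordinate_bound:
  assumes A: "A \<in> carrier_mat m n" and m: "m \<ge> 1" and bdd: "bounded_vecs (polyhedron_le_one A)"
    and x: "x \<in> polyhedron_le_one A"
    and D: "1 \<le> D" "\<And>i j. i < m \<Longrightarrow> j < n \<Longrightarrow> D * A $$ (i, j) \<in> \<int>"
    and g: "1 \<le> g" "\<And>i j. i < m \<Longrightarrow> j < n \<Longrightarrow> \<bar>A $$ (i, j)\<bar> \<le> g" and j: "j < n"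
  shows "\<bar>x $ j\<bar> \<le> real n * (real m * g) * (D\<^sup>2 * (real n * (real m * g\<^sup>2))) ^ n" (is "_ \<le> ?R")
proof -
  have xn: "x \<in> carrier_vec n" using x by (simp add: polyhedron_le_one_iff[OF A])
  have unit: "unit_vec n j \<in> carrier_vec n" by simp
  obtain x1 where x1: "is_vertex A x1" "unit_vec n j \<bullet> x \<le> unit_vec n j \<bullet> x1"
    using exists_better_vertex[OF A bdd unit x] by blast
  obtain x2 where x2: "is_vertex A x2" "((- 1) \<cdot>\<^sub>v unit_vec n j) \<bullet> x \<le> ((- 1) \<cdot>\<^sub>v unit_vec n j) \<bullet> x2"
    using exists_better_vertex[OF A bdd _ x, of "(- 1) \<cdot>\<^sub>v unit_vec n j"] by auto
  have n12: "x1 \<in> carrier_vec n" "x2 \<in> carrier_vec n"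
    using x1(1) x2(1) by (auto simp: is_vertex_def polyhedron_le_one_iff[OF A])
  have "x $ j \<le> x1 $ j" "x2 $ j \<le> x $ j"
    using x1(2) x2(2) xn n12 j by simp_all
  moreover have "\<bar>x1 $ j\<bar> \<le> ?R" "\<bar>x2 $ j\<bar> \<le> ?R"
    using vertex_coordinate_bound[OF A m _ D g j] x1(1) x2(1) by blast+
  ultimately show ?thesis by linarith
qed

section \<open>Orbits enter a scaled Lyapunov ellipsoid\<close>

text \<open>A weak bound, linear in \<open>1/r\<close>, suffices: the number of steps may be exponential in the size of the data, and this
  form avoids logarithms.\<close>

lemma geometric_decay_le:
  fixes lam :: real
  assumes "1 \<le> lam"
  shows "(1 - 1 / lam) ^ r \<le> 1 / (1 + real r / lam)"
proof -
  have "(1 - 1 / lam) ^ r \<le> exp (- (1 / lam)) ^ r"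
    using assms exp_ge_add_one_self[of "- (1 / lam)"] by (intro power_mono) auto
  also have "\<dots> = 1 / exp (real r / lam)"
    using exp_of_nat_mult[of r "- (1 / lam)"] by (simp add: exp_minus inverse_eq_divide)
  also have "\<dots> \<le> 1 / (1 + real r / lam)"
    using assms exp_ge_add_one_self[of "real r / lam"]
    by (intro divide_left_mono) (auto intro!: mult_pos_pos add_pos_nonneg)
  finally show ?thesis .
qed

text \<open>The scaling of \<open>Y\<close> makes the ellipsoid satisfy the constraints given by the rows of \<open>A\<close>. Moving \<open>G^r\<close> to
  the test vector, \<open>(w \<bullet> G^r x)\<^sup>2\<close> is at most \<open>R\<close> times the squared norm of the dual orbit of \<open>w\<close>, which has
  decayed below the scaled form by time \<open>r\<close>.\<close>

lemma RLDLP_feasible_imp_SDP: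
  assumes A: "A \<in> carrier_mat m n" and G: "G \<in> carrier_mat n n" and n: "n \<ge> 1"
    and sr: "real_spectral_radius G < 1"
    and Y: "Y \<in> carrier_mat n n" "sym_mat Y" "Y - G * Y * G\<^sup>T = 1\<^sub>m n"
    and lam: "1 \<le> lam" "\<And>v. v \<in> carrier_vec n \<Longrightarrow> v \<bullet> (Y *\<^sub>v v) \<le> lam * (v \<bullet> v)"
    and R: "0 \<le> R" "\<And>x. x \<in> polyhedron_le_one A \<Longrightarrow> x \<bullet> x \<le> R"
    and s: "0 < s" "\<And>i. i < m \<Longrightarrow> row A i \<bullet> row A i \<le> s"
    and r: "lam\<^sup>2 * R * s \<le> real r" and x: "x \<in> feasible_RLDLP A G"
  shows "x \<in> fst ` feasible_SDP A G r"
proof -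
  define al where "al = 1 / (lam * s)"
  have al: "0 < al" using lam s by (simp add: al_def)
  define Q where "Q = al \<cdot>\<^sub>m Y"
  have Qn: "Q \<in> carrier_mat n n" using Y by (simp add: Q_def)
  have symQ: "sym_mat Q"
  proof -
    have "Y $$ (i, j) = Y $$ (j, i)" if "i < n" "j < n" for i j
      using Y(1,2) that index_transpose_mat(1)[of j Y i] by (auto simp: sym_mat_def)
    then show ?thesis using Y(1) by (auto simp: Q_def sym_mat_def intro!: eq_matI)
  qed
  have Qv: "v \<bullet> (Q *\<^sub>v v) = al * (v \<bullet> (Y *\<^sub>v v))" if "v \<in> carrier_vec n" for v
  proof -
    have "Q *\<^sub>v v = al \<cdot>\<^sub>v (Y *\<^sub>v v)"
      using that Y by (intro eq_vecI) (auto simp: Q_def)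
    then show ?thesis using that Y by simp
  qed
  note ge = lyapunov_ge_identity[OF G n sr Y(1,3)]
  have xn: "x \<in> carrier_vec n" and xk: "\<And>k i. i < m \<Longrightarrow> row A i \<bullet> (G ^\<^sub>m k *\<^sub>v x) \<le> 1"
    using x by (auto simp: feasible_RLDLP_iff[OF A G])
  have xx: "x \<bullet> x \<le> R"
    using xk[of _ 0] xn G by (intro R(2)) (simp add: polyhedron_le_one_iff[OF A])
  have "pos_def Q"
  proof -
    have "0 < v \<bullet> (Q *\<^sub>v v)" if "v \<in> carrier_vec n" "v \<noteq> 0\<^sub>v n" for v
      using Qv[OF that(1)] al ge[OF that(1)] scalar_prod_self_pos[OF that] by simp
    then show ?thesis using symQ Qn by (simp add: pos_def_def)
  qed
  moreover have "G * Q * G\<^sup>T \<preceq>\<^sub>L Q"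
  proof -
    have "(G\<^sup>T *\<^sub>v v) \<bullet> (Q *\<^sub>v (G\<^sup>T *\<^sub>v v)) \<le> v \<bullet> (Q *\<^sub>v v)" if v: "v \<in> carrier_vec n" for v
    proof -
      have "0 \<le> v \<bullet> v" by (simp add: scalar_prod_def sum_nonneg)
      moreover have Gv: "G\<^sup>T *\<^sub>v v \<in> carrier_vec n" using G v by simp
      ultimately show ?thesis
        using lyapunov_dual_step[OF G Y(1,3) v] al unfolding Qv[OF v] Qv[OF Gv] by simp
    qed
    then show ?thesis
      using loewner_le_congruence_iff[of Q n "G\<^sup>T"] symQ Qn G by simp
  qed
  moreover have "row A i \<bullet> (Q *\<^sub>v row A i) \<le> 1" if i: "i < m" for i
  proof -
    have a: "row A i \<in> carrier_vec n" using A i by auto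
    have "row A i \<bullet> (Y *\<^sub>v row A i) \<le> lam * s"
      using lam(2)[OF a] mult_left_mono[OF s(2)[OF i], of lam] lam(1) by linarith
    then show ?thesis
      unfolding Qv[OF a] using lam s by (simp add: al_def field_simps)
  qed
  moreover have "in_ellipsoid Q (G ^\<^sub>m r *\<^sub>v x)"
  proof -
    have "(w \<bullet> (G ^\<^sub>m r *\<^sub>v x))\<^sup>2 \<le> w \<bullet> (Q *\<^sub>v w)" if w: "w \<in> carrier_vec n" for w
    proof -
      let ?p = "(G ^\<^sub>m r)\<^sup>T *\<^sub>v w"
      have Gr: "G ^\<^sub>m r \<in> carrier_mat n n" using G by simp
      have p: "?p \<in> carrier_vec n" using Gr w by (intro mult_mat_vec_carrier[of _ n n]) auto
      have q: "0 \<le> w \<bullet> (Y *\<^sub>v w)"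
        using ge[OF w] sum_nonneg[of "{0..<n}" "\<lambda>i. w $ i * w $ i"] w by (simp add: scalar_prod_def)
      have "(w \<bullet> (G ^\<^sub>m r *\<^sub>v x))\<^sup>2 = (?p \<bullet> x)\<^sup>2"
        using transpose_vec_mult_scalar[OF Gr xn w] by simp
      also have "\<dots> \<le> (?p \<bullet> ?p) * (x \<bullet> x)"
        using pos_def_cauchy_schwarz[OF pos_def_one one_carrier_mat p xn] p xn by simp
      also have "\<dots> \<le> ((1 - 1 / lam) ^ r * (w \<bullet> (Y *\<^sub>v w))) * R"
        using lyapunov_dual_contraction[OF G n sr Y(1,3) lam w, of r] xx q lam(1) R(1)
        by (intro mult_mono) (auto simp: scalar_prod_def sum_nonneg)
      also have "\<dots> = ((1 - 1 / lam) ^ r * R) * (w \<bullet> (Y *\<^sub>v w))" by simp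
      also have "\<dots> \<le> al * (w \<bullet> (Y *\<^sub>v w))"
      proof (rule mult_right_mono[OF _ q])
        have "(1 - 1 / lam) ^ r * R \<le> 1 / (1 + real r / lam) * R"
          using geometric_decay_le[OF lam(1)] R(1) by (rule mult_right_mono)
        also have "\<dots> \<le> al"
        proof -
          have "R * (lam * s) \<le> real r / lam"
            using r lam(1) by (simp add: field_simps power2_eq_square)
          then have "R * (lam * s) \<le> 1 + real r / lam" by simp
          moreover have "0 < 1 + real r / lam" using lam(1) by (intro add_pos_nonneg) auto
          ultimately show ?thesis
            using lam(1) s(1) by (simp add: al_def pos_divide_le_eq pos_le_divide_eq)
        qed
        finally show "(1 - 1 / lam) ^ r * R \<le> al" .
      qed
      finally show ?thesis by (simp add: Qv[OF w])
    qed
    moreover have "dim_row Q = n" using Qn by simp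
    moreover have "G ^\<^sub>m r *\<^sub>v x \<in> carrier_vec n" by (rule pow_mat_mult_vec_carrier[OF G xn])
    ultimately show ?thesis by (simp add: in_ellipsoid_def)
  qed
  ultimately have "(x, Q) \<in> feasible_SDP A G r"
    using xn xk Qn by (simp add: feasible_SDP_iff[OF A G])
  then show ?thesis by (rule image_eqI[rotated]) simp
qed

text \<open>Each term is estimated by \<open>\<bar>v_i * v_j\<bar> \<le> (v_i\<^sup>2 + v_j\<^sup>2) / 2\<close>.\<close>

lemma quad_form_le:
  fixes Y :: "real mat"
  assumes Y: "Y \<in> carrier_mat n n" and b: "\<And>i j. i < n \<Longrightarrow> j < n \<Longrightarrow> \<bar>Y $$ (i, j)\<bar> \<le> b" "0 \<le> b"
    and v: "v \<in> carrier_vec n"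
  shows "v \<bullet> (Y *\<^sub>v v) \<le> real n * b * (v \<bullet> v)"
proof -
  have "v \<bullet> (Y *\<^sub>v v) = (\<Sum>i<n. \<Sum>j<n. v $ i * Y $$ (i, j) * v $ j)"
    using Y v by (simp add: scalar_prod_def atLeast0LessThan sum_distrib_left mult.assoc)
  also have "\<dots> \<le> (\<Sum>i<n. \<Sum>j<n. b * ((v $ i)\<^sup>2 + (v $ j)\<^sup>2) / 2)"
  proof (intro sum_mono)
    fix i j assume ij: "i \<in> {..<n}" "j \<in> {..<n}"
    have "v $ i * Y $$ (i, j) * v $ j \<le> \<bar>Y $$ (i, j)\<bar> * \<bar>v $ i * v $ j\<bar>"
      using abs_ge_self[of "v $ i * Y $$ (i, j) * v $ j"] by (simp add: abs_mult mult_ac)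
    also have "\<dots> \<le> b * \<bar>v $ i * v $ j\<bar>" using ij b by (intro mult_right_mono) auto
    also have "\<dots> \<le> b * (((v $ i)\<^sup>2 + (v $ j)\<^sup>2) / 2)"
    proof (rule mult_left_mono[OF _ b(2)])
      have "0 \<le> (\<bar>v $ i\<bar> - \<bar>v $ j\<bar>)\<^sup>2" by simp
      then show "\<bar>v $ i * v $ j\<bar> \<le> ((v $ i)\<^sup>2 + (v $ j)\<^sup>2) / 2"
        by (simp add: power2_diff abs_mult)
    qed
    finally show "v $ i * Y $$ (i, j) * v $ j \<le> b * ((v $ i)\<^sup>2 + (v $ j)\<^sup>2) / 2" by simp
  qed
  also have "\<dots> = real n * b * (\<Sum>i<n. (v $ i)\<^sup>2)"
    by (simp add: sum.distrib sum_divide_distrib[symmetric] sum_distrib_left[symmetric] algebra_simps)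
  also have "(\<Sum>i<n. (v $ i)\<^sup>2) = v \<bullet> v"
    using v by (simp add: scalar_prod_def atLeast0LessThan power2_eq_square)
  finally show ?thesis .
qed

section \<open>A machine that writes a power of two\<close>

text \<open>Tape 1 holds the input, tape 2 receives one mark per input letter, and tape 3 is the output. State \<open>0\<close> writes the
  leading \<open>One\<close> (code \<open>2\<close>; the code of \<open>Zero\<close> is \<open>1\<close>). State \<open>1\<close> makes the marks. From state \<open>3\<close> on, head 2
  sweeps to the left over the marks: the states \<open>3, \<dots>, 2 + c\<close> write \<open>c\<close> \<open>Zero\<close>s per mark, and only the last of
  them moves head 2. State \<open>2\<close> rewinds head 2 and moves head 1 one letter to the left. The
  machine halts when head 1 has left the input.\<close>

definition zeros_delta :: "nat \<Rightarrow> nat \<Rightarrow> nat list \<Rightarrow> nat \<times> (nat \<times> move) list" where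
  "zeros_delta c q ss = (let a = ss ! 0; b = ss ! 1; d = ss ! 2 in
     if q = 0 then (1, [(a, Stay), (b, Stay), (2, MoveRight)])
     else if q = 1 then
       (if a = 0 then (3, [(a, MoveLeft), (b, MoveLeft), (d, Stay)])
        else (1, [(a, MoveRight), (1, MoveRight), (d, Stay)]))
     else if q = 2 then
       (if b = 0 then (3, [(a, MoveLeft), (b, MoveLeft), (d, Stay)])
        else (2, [(a, Stay), (b, MoveRight), (d, Stay)]))
     else if q = 3 \<and> a = 0 then (3 + c, [(a, Stay), (b, Stay), (d, Stay)])
     else if q = 3 \<and> b = 0 then (2, [(a, Stay), (b, MoveRight), (d, Stay)])
     else if q + 1 = 3 + c then (3, [(a, Stay), (b, MoveLeft), (1, MoveRight)])
     else (q + 1, [(a, Stay), (b, Stay), (1, MoveRight)]))"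

definition zeros_tm :: "nat \<Rightarrow> turing_machine" where
  "zeros_tm c = \<lparr>tm_tapes = 3, tm_halt = 3 + c, tm_symbols = 8, tm_delta = zeros_delta c\<rparr>"

lemma well_formed_zeros_tm: "well_formed_tm (zeros_tm c)"
proof -
  have "case zeros_delta c q ss of (q', acts) \<Rightarrow>
      q' \<le> 3 + c \<and> length acts = 3 \<and> (\<forall>(s, d) \<in> set acts. s < 8)"
    if "q < 3 + c" "length ss = 3" "\<forall>s \<in> set ss. s < 8" for q ss
  proof -
    have "ss ! 0 < 8" "ss ! 1 < 8" "ss ! 2 < 8"
      using that(2,3) by (auto intro!: nth_mem)
    then show ?thesis
      using that(1) by (auto simp: zeros_delta_def Let_def)
  qed
  then show ?thesis
    by (simp add: well_formed_tm_def zeros_tm_def)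
qed

definition runs_to :: "turing_machine \<Rightarrow> nat \<Rightarrow> config \<Rightarrow> config \<Rightarrow> bool" where
  "runs_to M t C C' \<longleftrightarrow> (tm_step M ^^ t) C = C'"

lemma runs_to_trans: "runs_to M s C C' \<Longrightarrow> runs_to M t C' C'' \<Longrightarrow> runs_to M (s + t) C C''"
  by (auto simp: runs_to_def add.commute[of s t] funpow_add)

lemma runs_to_0: "runs_to M 0 C C"
  by (simp add: runs_to_def)

lemma runs_to_1: "tm_step M C = C' \<Longrightarrow> runs_to M 1 C C'"
  by (simp add: runs_to_def)

lemma runs_to_repeat:
  assumes "\<And>i. i < n \<Longrightarrow> runs_to M t (C i) (C (Suc i))"
  shows "runs_to M (n * t) (C 0) (C n)"
  using assms
proof (induction n)
  case 0
  then show ?case by (simp add: runs_to_0)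
next
  case (Suc n)
  have "runs_to M (n * t + t) (C 0) (C (Suc n))"
    using Suc by (intro runs_to_trans[of M "n * t" "C 0" "C n"]) auto
  then show ?case by (simp add: add.commute)
qed

lemma computes_within_if_runs_to:
  assumes "runs_to M t (initial_config M w) (tm_halt M, ts)"
    and "fst (last ts) = word_on_tape v" and "t \<le> t'"
  shows "computes_within M w v t'"
proof -
  have halted: "(tm_step M ^^ k) (tm_halt M, ts) = (tm_halt M, ts)" for k
    by (induction k) (simp_all add: tm_step_def)
  have "(tm_step M ^^ t') (initial_config M w) = (tm_halt M, ts)"
    using assms(1,3) halted[of "t' - t"] le_add_diff_inverse2[OF assms(3)] funpow_add[of "t' - t" t "tm_step M"]
    by (simp add: runs_to_def)
  then show ?thesis
    using assms(2) by (simp add: computes_within_def)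
qed

lemma letter_code_pos: "letter_code a \<noteq> 0"
  by (cases a) auto

lemma word_on_tape_eq_0_iff: "word_on_tape w i = 0 \<longleftrightarrow> i < 0 \<or> int (length w) \<le> i"
  by (auto simp: word_on_tape_def letter_code_pos)

lemma word_on_tape_snoc:
  "(word_on_tape w)(int (length w) := letter_code a) = word_on_tape (w @ [a])"
  by (auto simp: word_on_tape_def fun_eq_iff nth_append)

text \<open>Any nonblank symbol can serve as a mark. With the code of \<open>Zero\<close>, the tape is a word like the others.\<close>

abbreviation marks :: "nat \<Rightarrow> int \<Rightarrow> nat" where
  "marks n \<equiv> word_on_tape (replicate n Zero)"

abbreviation power_word :: "nat \<Rightarrow> letter list" where
  "power_word k \<equiv> One # replicate k Zero"

lemma marks_Suc: "(marks n)(int n := 1) = marks (Suc n)"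
  using word_on_tape_snoc[of "replicate n Zero" Zero] by (simp add: replicate_append_same)

lemma power_word_Suc: "(word_on_tape (power_word k))(1 + int k := Suc 0) = word_on_tape (power_word (Suc k))"
  using word_on_tape_snoc[of "power_word k" Zero] by (simp add: replicate_append_same)

context
  fixes c :: nat and w :: "letter list"
  assumes c: "c > 0"
begin

abbreviation (input) conf :: "nat \<Rightarrow> int \<Rightarrow> nat \<Rightarrow> int \<Rightarrow> nat \<Rightarrow> config" where
  "conf q i n j k \<equiv>
     (q, [(word_on_tape w, i), (marks n, j), (word_on_tape (power_word k), 1 + int k)])"

lemma zeros_tm_start:
  "runs_to (zeros_tm c) 1 (initial_config (zeros_tm c) w) (conf 1 0 0 0 0)"
  using word_on_tape_snoc[of "[]" One] c
  by (intro runs_to_1)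
     (simp add: initial_config_def zeros_tm_def tm_step_def zeros_delta_def numeral_2_eq_2 numeral_3_eq_3)

lemma zeros_tm_copy:
  "runs_to (zeros_tm c) (length w + 1) (conf 1 0 0 0 0)
     (conf 3 (int (length w) - 1) (length w) (int (length w) - 1) 0)"
proof (rule runs_to_trans)
  have "runs_to (zeros_tm c) 1 (conf 1 (int i) i (int i) 0)
          (conf 1 (int (Suc i)) (Suc i) (int (Suc i)) 0)" if "i < length w" for i
    using that c marks_Suc[of i]
    by (intro runs_to_1)
       (simp add: zeros_tm_def tm_step_def zeros_delta_def word_on_tape_eq_0_iff add.commute)
  from runs_to_repeat[where C = "\<lambda>i. conf 1 (int i) i (int i) 0" and n = "length w", OF this]
  show "runs_to (zeros_tm c) (length w) (conf 1 0 0 0 0)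
     (conf 1 (int (length w)) (length w) (int (length w)) 0)"
    by simp
  show "runs_to (zeros_tm c) 1 (conf 1 (int (length w)) (length w) (int (length w)) 0)
     (conf 3 (int (length w) - 1) (length w) (int (length w) - 1) 0)"
    using c by (intro runs_to_1)
       (simp add: zeros_tm_def tm_step_def zeros_delta_def word_on_tape_eq_0_iff)
qed

lemma zeros_tm_block:
  assumes "0 \<le> i" "i < int (length w)" "0 \<le> j" "j < int n"
  shows "runs_to (zeros_tm c) c (conf 3 i n j k) (conf 3 i n (j - 1) (k + c))"
proof -
  have nz: "word_on_tape w i \<noteq> 0" "marks n j \<noteq> 0"
    using assms by (auto simp: word_on_tape_eq_0_iff)
  \<comment> \<open>The first \<open>c - 1\<close> steps only write; the last one also moves head 2 and returns to state 3.\<close>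
  have "runs_to (zeros_tm c) 1 (conf (3 + l) i n j (k + l)) (conf (3 + Suc l) i n j (k + Suc l))"
    if "l < c - 1" for l
    using nz power_word_Suc[of "k + l"] less_diff_conv[THEN iffD1, OF that]
    by (intro runs_to_1)
       (simp add: zeros_tm_def tm_step_def zeros_delta_def Let_def numeral_3_eq_3 add_ac)
  from runs_to_repeat[where C = "\<lambda>l. conf (3 + l) i n j (k + l)" and n = "c - 1", OF this]
  have "runs_to (zeros_tm c) (c - 1) (conf 3 i n j k) (conf (2 + c) i n j (k + (c - 1)))"
    using c by simp
  moreover have "runs_to (zeros_tm c) 1 (conf (2 + c) i n j (k + (c - 1))) (conf 3 i n (j - 1) (k + c))"
    using c nz power_word_Suc[of "k + (c - 1)"]
    by (intro runs_to_1)
       (simp add: zeros_tm_def tm_step_def zeros_delta_def Let_def numeral_3_eq_3 add_ac)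
  ultimately show ?thesis
    using runs_to_trans[of "zeros_tm c" "c - 1" _ _ 1] c by fastforce
qed

text \<open>Apart from the growing output, a sweep reproduces the configuration with head 1 one letter further
  to the left, so that the sweeps can be iterated.\<close>

lemma zeros_tm_sweep:
  assumes "0 \<le> i" "i < int (length w)"
  shows "runs_to (zeros_tm c) (n * c + (1 + (n + 1))) (conf 3 i n (int n - 1) k)
     (conf 3 (i - 1) n (int n - 1) (k + n * c))"
proof (intro runs_to_trans)
  have "runs_to (zeros_tm c) c (conf 3 i n (int n - 1 - int l) (k + l * c))
     (conf 3 i n (int n - 1 - int (Suc l)) (k + Suc l * c))" if "l < n" for l
    using zeros_tm_block[of i "int n - 1 - int l" n "k + l * c"] assms that
    by (simp add: algebra_simps)
  from runs_to_repeat[where C = "\<lambda>l. conf 3 i n (int n - 1 - int l) (k + l * c)" and n = n, OF this]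
  show "runs_to (zeros_tm c) (n * c) (conf 3 i n (int n - 1) k) (conf 3 i n (- 1) (k + n * c))"
    by simp
  show "runs_to (zeros_tm c) 1 (conf 3 i n (- 1) (k + n * c)) (conf 2 i n 0 (k + n * c))"
    using assms c by (intro runs_to_1)
       (simp add: zeros_tm_def tm_step_def zeros_delta_def word_on_tape_eq_0_iff)
  have "runs_to (zeros_tm c) 1 (conf 2 i n (int l) (k + n * c)) (conf 2 i n (int (Suc l)) (k + n * c))"
    if "l < n" for l
    using that by (intro runs_to_1)
       (simp add: zeros_tm_def tm_step_def zeros_delta_def word_on_tape_eq_0_iff add.commute)
  from runs_to_repeat[where C = "\<lambda>l. conf 2 i n (int l) (k + n * c)" and n = n, OF this]
  show "runs_to (zeros_tm c) n (conf 2 i n 0 (k + n * c)) (conf 2 i n (int n) (k + n * c))"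
    by simp
  show "runs_to (zeros_tm c) 1 (conf 2 i n (int n) (k + n * c)) (conf 3 (i - 1) n (int n - 1) (k + n * c))"
    by (intro runs_to_1)
       (simp add: zeros_tm_def tm_step_def zeros_delta_def word_on_tape_eq_0_iff)
qed

lemma zeros_tm_computes:
  assumes "length w + length w * (length w * (c + 1) + 2) + 3 \<le> t"
  shows "computes_within (zeros_tm c) w (power_word (c * length w * length w)) t"
proof -
  let ?L = "length w"
  have "runs_to (zeros_tm c) (?L * c + (1 + (?L + 1)))
      (conf 3 (int ?L - 1 - int l) ?L (int ?L - 1) (l * (?L * c)))
      (conf 3 (int ?L - 1 - int (Suc l)) ?L (int ?L - 1) (Suc l * (?L * c)))" if "l < ?L" for l
    using zeros_tm_sweep[of "int ?L - 1 - int l" ?L "l * (?L * c)"] that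
    by (simp add: algebra_simps)
  from runs_to_repeat[where C = "\<lambda>l. conf 3 (int ?L - 1 - int l) ?L (int ?L - 1) (l * (?L * c))" and n = ?L, OF this]
  have sweeps: "runs_to (zeros_tm c) (?L * (?L * c + (1 + (?L + 1))))
      (conf 3 (int ?L - 1) ?L (int ?L - 1) 0)
      (conf 3 (- 1) ?L (int ?L - 1) (?L * (?L * c)))"
    by simp
  have "runs_to (zeros_tm c) 1 (conf 3 (- 1) ?L (int ?L - 1) (?L * (?L * c)))
      (conf (tm_halt (zeros_tm c)) (- 1) ?L (int ?L - 1) (?L * (?L * c)))"
    by (intro runs_to_1)
       (simp add: zeros_tm_def tm_step_def zeros_delta_def word_on_tape_eq_0_iff c)
  from runs_to_trans[OF zeros_tm_start runs_to_trans[OF zeros_tm_copy runs_to_trans[OF sweeps this]]]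
  show ?thesis
    by (rule computes_within_if_runs_to) (use assms in \<open>simp_all add: algebra_simps\<close>)
qed

end

lemma encode_nat_power_of_2: "encode_nat (2 ^ k) = power_word k"
proof (induction k)
  case (Suc k)
  have "encode_nat (2 ^ Suc k) = encode_nat (2 ^ k) @ [Zero]"
    by (subst encode_nat.simps) (simp add: leD one_le_power self_le_power)
  with Suc show ?case by (simp add: replicate_append_same)
qed simp

section \<open>Lengths of encodings\<close>

declare encode_nat.simps [simp del]

text \<open>The length is the number of binary digits, except that the number \<open>0\<close> also takes one digit.\<close>

lemma encode_nat_length_bounds:
  "1 \<le> length (encode_nat k) \<and> k < 2 ^ length (encode_nat k) \<and>
   (1 \<le> k \<longrightarrow> 2 ^ (length (encode_nat k) - 1) \<le> k)"
proof (induction k rule: less_induct)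
  case (less k)
  show ?case
  proof (cases "k < 2")
    case True
    then have "length (encode_nat k) = 1" by (subst encode_nat.simps) simp
    then show ?thesis using True by simp
  next
    case False
    then have len: "length (encode_nat k) = Suc (length (encode_nat (k div 2)))"
      by (subst encode_nat.simps) simp
    have IH: "1 \<le> length (encode_nat (k div 2))" "k div 2 < 2 ^ length (encode_nat (k div 2))"
      "2 ^ (length (encode_nat (k div 2)) - 1) \<le> k div 2"
      using less.IH[of "k div 2"] False by auto
    have "2 * 2 ^ (length (encode_nat (k div 2)) - 1) = (2::nat) ^ length (encode_nat (k div 2))"
      using IH(1) by (cases "length (encode_nat (k div 2))") simp_all
    with IH(3) have "2 ^ length (encode_nat (k div 2)) \<le> k" by linarith
    moreover have "k < 2 * 2 ^ length (encode_nat (k div 2))" using IH(2) by linarith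
    ultimately show ?thesis unfolding len by simp
  qed
qed

lemma length_encode_nat_le_log:
  "length (encode_nat k) \<le> 1 + nat \<lceil>log 2 (real k + 1)\<rceil>"
proof (cases "1 \<le> k")
  case True
  let ?l = "length (encode_nat k)"
  have "(2::real) ^ (?l - 1) \<le> real k"
    using encode_nat_length_bounds[of k] True by (metis of_nat_le_iff of_nat_numeral of_nat_power)
  moreover have "2 powr real (?l - 1) = 2 ^ (?l - 1)" by (simp add: powr_realpow)
  ultimately have "2 powr real (?l - 1) \<le> real k + 1" by linarith
  then have "real (?l - 1) \<le> log 2 (real k + 1)" by (subst le_log_iff) auto
  then have "?l - 1 \<le> nat \<lceil>log 2 (real k + 1)\<rceil>" by linarith
  then show ?thesis by linarith
next
  case False
  then have "k = 0" by simp
  then show ?thesis by (simp add: encode_nat.simps)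
qed

lemma length_encode_int:
  "real_of_int \<bar>k\<bar> \<le> 2 ^ length (encode_int k)"
  "length (encode_int k) \<le> 2 + nat \<lceil>log 2 (real_of_int \<bar>k\<bar> + 1)\<rceil>"
proof -
  have "real (nat \<bar>k\<bar>) \<le> 2 ^ length (encode_nat (nat \<bar>k\<bar>))"
    using encode_nat_length_bounds[of "nat \<bar>k\<bar>"]
    by (metis less_imp_le of_nat_le_iff of_nat_numeral of_nat_power)
  also have "\<dots> \<le> 2 ^ length (encode_int k)" by (intro power_increasing) (auto simp: encode_int_def)
  finally show "real_of_int \<bar>k\<bar> \<le> 2 ^ length (encode_int k)" by simp
  show "length (encode_int k) \<le> 2 + nat \<lceil>log 2 (real_of_int \<bar>k\<bar> + 1)\<rceil>"
    using length_encode_nat_le_log[of "nat \<bar>k\<bar>"] by (auto simp add: encode_int_def simp del: abs_of_neg)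
qed

definition denom :: "rat \<Rightarrow> int" where
  "denom a = snd (quotient_of a)"

lemma denom:
  shows "1 \<le> denom a" "real_of_int (denom a) \<le> 2 ^ length (encode_rat a)"
    "real_of_int (denom a) * real_of_rat a \<in> \<int>"
    "\<bar>real_of_rat a\<bar> \<le> 2 ^ length (encode_rat a)"
    "length (encode_rat a) + 1 \<le> 6 * rat_size a"
proof -
  obtain p q where pq: "quotient_of a = (p, q)" by fastforce
  have q: "0 < q" using quotient_of_denom_pos[OF pq] .
  have a: "real_of_rat a = real_of_int p / real_of_int q"
    unfolding quotient_of_div[OF pq] by (simp add: of_rat_divide)
  have len: "length (encode_rat a) = length (encode_int p) + 1 + length (encode_int q)"
    by (simp add: encode_rat_def pq)
  show "1 \<le> denom a" using q by (simp add: denom_def pq)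
  show "real_of_int (denom a) * real_of_rat a \<in> \<int>" using q by (simp add: denom_def pq a)
  have "real_of_int q \<le> 2 ^ length (encode_int q)" using length_encode_int(1)[of q] q by simp
  also have "\<dots> \<le> 2 ^ length (encode_rat a)" by (intro power_increasing) (auto simp: len)
  finally show "real_of_int (denom a) \<le> 2 ^ length (encode_rat a)" by (simp add: denom_def pq)
  have "\<bar>real_of_rat a\<bar> \<le> real_of_int \<bar>p\<bar>"
    using q unfolding a by (simp add: abs_divide divide_le_eq mult_le_cancel_left1)
  also have "\<dots> \<le> 2 ^ length (encode_int p)" by (rule length_encode_int(1))
  also have "\<dots> \<le> 2 ^ length (encode_rat a)" by (intro power_increasing) (auto simp: len)
  finally show "\<bar>real_of_rat a\<bar> \<le> 2 ^ length (encode_rat a)" .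
  show "length (encode_rat a) + 1 \<le> 6 * rat_size a"
    using length_encode_int(2)[of p] length_encode_int(2)[of q] by (simp add: len rat_size_def pq)
qed

lemma length_encode_row:
  "length (encode_row v) = (\<Sum>j<dim_vec v. length (encode_rat (v $ j)) + 1) + 1"
proof -
  have "length (encode_row v) = sum_list (map (\<lambda>j. length (encode_rat (v $ j)) + 1) [0..<dim_vec v]) + 1"
    by (simp add: encode_row_def length_concat comp_def list_of_vec_map)
  also have "sum_list (map (\<lambda>j. length (encode_rat (v $ j)) + 1) [0..<dim_vec v])
      = (\<Sum>j<dim_vec v. length (encode_rat (v $ j)) + 1)"
    unfolding interv_sum_list_conv_sum_set_nat by (simp only: set_upt atLeast0LessThan)
  finally show ?thesis .
qed

lemma length_encode_mat:
  "length (encode_mat M) =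
    (\<Sum>i<dim_row M. (\<Sum>j<dim_col M. length (encode_rat (M $$ (i, j))) + 1) + 1)"
proof -
  have "length (encode_mat M) = sum_list (map (\<lambda>i. length (encode_row (row M i))) [0..<dim_row M])"
    by (simp add: encode_mat_def rows_def length_concat comp_def)
  also have "\<dots> = (\<Sum>i<dim_row M. length (encode_row (row M i)))"
    unfolding interv_sum_list_conv_sum_set_nat by (simp only: set_upt atLeast0LessThan)
  also have "\<dots> = (\<Sum>i<dim_row M. (\<Sum>j<dim_col M. length (encode_rat (M $$ (i, j))) + 1) + 1)"
    by (intro sum.cong refl) (simp add: length_encode_row)
  finally show ?thesis .
qed

lemma dims_le_length_encode_mat:
  "dim_row M * dim_col M \<le> length (encode_mat M)" "dim_row M \<le> length (encode_mat M)"
proof -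
  have "dim_row M * dim_col M = (\<Sum>i<dim_row M. \<Sum>j<dim_col M. 1)" by simp
  also have "\<dots> \<le> length (encode_mat M)"
    unfolding length_encode_mat by (intro sum_mono) (rule trans_le_add1, intro sum_mono, simp)
  finally show "dim_row M * dim_col M \<le> length (encode_mat M)" .
  have "dim_row M = (\<Sum>i<dim_row M. 1)" by simp
  also have "\<dots> \<le> length (encode_mat M)"
    unfolding length_encode_mat by (intro sum_mono) simp
  finally show "dim_row M \<le> length (encode_mat M)" .
qed

lemma length_encode_mat_le_mat_size:
  assumes "dim_col M \<ge> 1"
  shows "length (encode_mat M) \<le> 6 * mat_size M"
proof -
  have "length (encode_mat M) \<le> (\<Sum>i<dim_row M. (\<Sum>j<dim_col M. 6 * rat_size (M $$ (i, j))) + dim_col M)"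
    unfolding length_encode_mat using assms by (intro sum_mono add_mono denom(5)) auto
  also have "\<dots> = 6 * (\<Sum>i<dim_row M. \<Sum>j<dim_col M. rat_size (M $$ (i, j))) + dim_row M * dim_col M"
    by (simp add: sum.distrib sum_distrib_left)
  finally show ?thesis by (simp add: mat_size_def)
qed

definition common_denom :: "rat mat \<Rightarrow> int" where
  "common_denom M = (\<Prod>i<dim_row M. \<Prod>j<dim_col M. denom (M $$ (i, j)))"

lemma common_denom:
  shows "1 \<le> real_of_int (common_denom M)" "real_of_int (common_denom M) \<le> 2 ^ length (encode_mat M)"
    and "i < dim_row M \<Longrightarrow> j < dim_col M \<Longrightarrow> real_of_int (common_denom M) * real_of_rat (M $$ (i, j)) \<in> \<int>"
    and "i < dim_row M \<Longrightarrow> j < dim_col M \<Longrightarrow> \<bar>real_of_rat (M $$ (i, j))\<bar> \<le> 2 ^ length (encode_mat M)"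
proof -
  have "1 \<le> common_denom M"
    unfolding common_denom_def by (intro prod_ge_1 denom(1))
  then show "1 \<le> real_of_int (common_denom M)" by simp
  have "real_of_int (common_denom M) = (\<Prod>i<dim_row M. \<Prod>j<dim_col M. real_of_int (denom (M $$ (i, j))))"
    by (simp add: common_denom_def)
  also have "\<dots> \<le> (\<Prod>i<dim_row M. \<Prod>j<dim_col M. 2 ^ length (encode_rat (M $$ (i, j))))"
    using denom(1,2) by (intro prod_mono conjI prod_nonneg) (auto intro: order_trans[of 0 1])
  also have "\<dots> = 2 ^ (\<Sum>i<dim_row M. \<Sum>j<dim_col M. length (encode_rat (M $$ (i, j))))"
    by (simp add: power_sum)
  also have "\<dots> \<le> 2 ^ length (encode_mat M)"
    unfolding length_encode_mat
    by (intro power_increasing sum_mono) (rule trans_le_add1, intro sum_mono, simp_all)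
  finally show "real_of_int (common_denom M) \<le> 2 ^ length (encode_mat M)" .
  assume ij: "i < dim_row M" "j < dim_col M"
  have "denom (M $$ (i, j)) dvd (\<Prod>j<dim_col M. denom (M $$ (i, j)))"
    using ij by (intro dvd_prodI) auto
  also have "\<dots> dvd common_denom M"
    unfolding common_denom_def using ij by (intro dvd_prodI[of _ _ "\<lambda>i. \<Prod>j<dim_col M. denom (M $$ (i, j))"]) auto
  finally obtain k where k: "common_denom M = denom (M $$ (i, j)) * k" by (elim dvdE)
  have "real_of_int (common_denom M) * real_of_rat (M $$ (i, j))
      = real_of_int k * (real_of_int (denom (M $$ (i, j))) * real_of_rat (M $$ (i, j)))"
    by (simp add: k)
  also have "\<dots> \<in> \<int>" by (intro Ints_mult denom(3)) simp
  finally show "real_of_int (common_denom M) * real_of_rat (M $$ (i, j)) \<in> \<int>" .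
  have "length (encode_rat (M $$ (i, j))) \<le> (\<Sum>j<dim_col M. length (encode_rat (M $$ (i, j))) + 1)"
    using ij by (intro order_trans[OF _ member_le_sum[of j]]) auto
  also have "\<dots> \<le> (\<Sum>j<dim_col M. length (encode_rat (M $$ (i, j))) + 1) + 1" by simp
  also have "\<dots> \<le> length (encode_mat M)"
    unfolding length_encode_mat
    using ij by (intro member_le_sum[of i _ "\<lambda>i. (\<Sum>j<dim_col M. length (encode_rat (M $$ (i, j))) + 1) + 1"]) auto
  finally have "(2::real) ^ length (encode_rat (M $$ (i, j))) \<le> 2 ^ length (encode_mat M)"
    by (intro power_increasing) auto
  then show "\<bar>real_of_rat (M $$ (i, j))\<bar> \<le> 2 ^ length (encode_mat M)"
    using denom(4)[of "M $$ (i, j)"] by linarith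
qed

section \<open>A sufficient number of steps\<close>

definition sufficient_step :: "real mat \<Rightarrow> real mat \<Rightarrow> nat \<Rightarrow> bool" where
  "sufficient_step A G r0 \<longleftrightarrow> (\<forall>r \<ge> r0. feasible_RLDLP A G \<subseteq> fst ` feasible_SDP A G r)"

lemma admissible_rows_nonempty:
  assumes "admissible m n A G"
  shows "m \<ge> 1"
proof -
  have "unit_vec n 0 \<in> carrier_vec n" "unit_vec n 0 \<noteq> (0\<^sub>v n :: real vec)"
    using assms by (auto simp: admissible_def vec_eq_iff)
  then show ?thesis
    using bounded_polyhedron_no_recession[of A m n "unit_vec n 0"] assms
    by (fastforce simp: admissible_def)
qed

text \<open>For real data it is enough that finite bounds \<open>lam\<close>, \<open>R\<close> and \<open>s\<close> exist.\<close>

lemma exists_sufficient_step: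
  assumes "admissible m n A G"
  shows "\<exists>r0. sufficient_step A G r0"
proof -
  have A: "A \<in> carrier_mat m n" and G: "G \<in> carrier_mat n n" and n: "n \<ge> 1"
    and sr: "real_spectral_radius G < 1" and bdd: "bounded_vecs (polyhedron_le_one A)"
    using assms by (auto simp: admissible_def)
  obtain Y where Y: "Y \<in> carrier_mat n n" "sym_mat Y" "Y - G * Y * G\<^sup>T = 1\<^sub>m n"
    using lyapunov_solution_exists[OF G n sr] by blast
  define b where "b = (\<Sum>i<n. \<Sum>j<n. \<bar>Y $$ (i, j)\<bar>)"
  have b: "\<bar>Y $$ (i, j)\<bar> \<le> b" if "i < n" "j < n" for i j
  proof -
    have "\<bar>Y $$ (i, j)\<bar> \<le> (\<Sum>j<n. \<bar>Y $$ (i, j)\<bar>)"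
      using that by (intro member_le_sum) auto
    also have "\<dots> \<le> b"
      unfolding b_def using that by (intro member_le_sum[of i _ "\<lambda>i. \<Sum>j<n. \<bar>Y $$ (i, j)\<bar>"]) (auto intro: sum_nonneg)
    finally show ?thesis .
  qed
  have b0: "0 \<le> b" by (simp add: b_def sum_nonneg)
  define lam where "lam = 1 + real n * b"
  have lam: "1 \<le> lam" using b0 by (simp add: lam_def)
  have Yle: "v \<bullet> (Y *\<^sub>v v) \<le> lam * (v \<bullet> v)" if v: "v \<in> carrier_vec n" for v
  proof -
    have "0 \<le> v \<bullet> v" by (simp add: scalar_prod_def sum_nonneg)
    then show ?thesis using quad_form_le[OF Y(1) b b0 v] by (simp add: lam_def algebra_simps)
  qed
  obtain B where B: "\<And>x. x \<in> polyhedron_le_one A \<Longrightarrow> sqrt (x \<bullet> x) \<le> B"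
    using bdd by (auto simp: bounded_vecs_def)
  have R: "x \<bullet> x \<le> B\<^sup>2" if "x \<in> polyhedron_le_one A" for x
    using B[OF that] by (rule sqrt_le_D)
  define s where "s = 1 + (\<Sum>i<m. row A i \<bullet> row A i)"
  have nonneg: "0 \<le> v \<bullet> v" for v :: "real vec" by (simp add: scalar_prod_def sum_nonneg)
  have s0: "0 < s" unfolding s_def by (intro add_pos_nonneg sum_nonneg nonneg) simp
  have s: "row A i \<bullet> row A i \<le> s" if "i < m" for i
    using member_le_sum[of i "{..<m}" "\<lambda>i. row A i \<bullet> row A i"] that nonneg by (simp add: s_def)
  have "sufficient_step A G (nat \<lceil>lam\<^sup>2 * B\<^sup>2 * s\<rceil>)"
    unfolding sufficient_step_def
  proof (intro allI impI subsetI)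
    fix r x assume r: "nat \<lceil>lam\<^sup>2 * B\<^sup>2 * s\<rceil> \<le> r" and x: "x \<in> feasible_RLDLP A G"
    have "lam\<^sup>2 * B\<^sup>2 * s \<le> real r" using r by linarith
    then show "x \<in> fst ` feasible_SDP A G r"
      by (intro RLDLP_feasible_imp_SDP[OF A G n sr Y lam, where R = "B\<^sup>2" and s = s] Yle R s0 s x) simp_all
  qed
  then show ?thesis by blast
qed

text \<open>All quantities are compared with powers of \<open>t = 2^N\<close>, where \<open>n\<^sup>2\<close>, \<open>m\<close>, the entries and the common denominators
  are at most \<open>t\<close>. The linear systems have at most \<open>N\<close> unknowns. Their solutions are at most \<open>t^(7 N)\<close>
  for the Lyapunov equation and \<open>t^(9 N)\<close> for the vertices, whence \<open>lam = t^(8 N)\<close>, \<open>R = t^(19 N)\<close>, \<open>s = t^(3 N)\<close> and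
  \<open>lam\<^sup>2 * R * s = t^(38 N)\<close>.\<close>

lemma sufficient_step_rational:
  assumes adm: "admissible m n (map_mat real_of_rat A) (map_mat real_of_rat G)"
  defines "N \<equiv> length (encode_data A G)"
  shows "sufficient_step (map_mat real_of_rat A) (map_mat real_of_rat G) (2 ^ (38 * N * N))"
proof -
  let ?A = "map_mat real_of_rat A" and ?G = "map_mat real_of_rat G"
  have A: "?A \<in> carrier_mat m n" and G: "?G \<in> carrier_mat n n" and n: "n \<ge> 1"
    and sr: "real_spectral_radius ?G < 1" and bdd: "bounded_vecs (polyhedron_le_one ?A)"
    using adm by (auto simp: admissible_def)
  have dims: "dim_row A = m" "dim_col A = n" "dim_row G = n" "dim_col G = n"
    using A G by auto
  have m: "m \<ge> 1" by (rule admissible_rows_nonempty[OF adm])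
  have N: "N = length (encode_mat A) + 1 + length (encode_mat G)"
    by (simp add: N_def encode_data_def)
  define t :: real where "t = 2 ^ N"
  have N1: "1 \<le> N" by (simp add: N)
  have t2: "2 \<le> t" using power_increasing[of 1 N "2::real"] N1 by (simp add: t_def)
  have t1: "1 \<le> t" using t2 by simp
  have tp: "t ^ i \<le> t ^ j" if "i \<le> j" for i j using that t1 by (rule power_increasing)
  have Nt: "real N \<le> t" unfolding t_def using less_exp[of N] by (metis less_imp_le of_nat_le_iff of_nat_numeral of_nat_power)
  have nnN: "n * n \<le> N" and mN: "m \<le> N"
    using dims_le_length_encode_mat[of A] dims_le_length_encode_mat[of G] by (auto simp: N dims)
  have nn: "n \<le> n * n" using n by simp
  have nt: "real n \<le> t" "real m \<le> t" "real (n * n) \<le> t"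
    using Nt nnN mN nn by linarith+
  have lenA: "2 ^ length (encode_mat A) \<le> t" and lenG: "2 ^ length (encode_mat G) \<le> t"
    unfolding t_def by (intro power_increasing; simp add: N)+
  have absA: "\<bar>?A $$ (i, j)\<bar> \<le> t" if "i < m" "j < n" for i j
    using common_denom(4)[where M = A and i = i and j = j] that lenA dims by simp
  have absG: "\<bar>?G $$ (i, j)\<bar> \<le> t" if "i < n" "j < n" for i j
    using common_denom(4)[where M = G and i = i and j = j] that lenG dims by simp
  define DA where "DA = real_of_int (common_denom A)"
  define DG where "DG = real_of_int (common_denom G)"
  have DA: "1 \<le> DA" "DA \<le> t" "\<And>i j. i < m \<Longrightarrow> j < n \<Longrightarrow> DA * ?A $$ (i, j) \<in> \<int>"
    using common_denom(1)[of A] order_trans[OF common_denom(2) lenA] common_denom(3)[where M = A] dims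
    by (auto simp: DA_def)
  have DG: "1 \<le> DG" "DG \<le> t" "\<And>i j. i < n \<Longrightarrow> j < n \<Longrightarrow> DG * ?G $$ (i, j) \<in> \<int>" "DG \<in> \<int>"
    using common_denom(1)[of G] order_trans[OF common_denom(2) lenG] common_denom(3)[where M = G] dims
    by (auto simp: DG_def)

  obtain Y where Y: "Y \<in> carrier_mat n n" "sym_mat Y" "Y - ?G * Y * ?G\<^sup>T = 1\<^sub>m n"
    using lyapunov_solution_exists[OF G n sr] by blast
  have Yb: "\<bar>Y $$ (i, j)\<bar> \<le> real (n * n) * (DG\<^sup>2 * (real (n * n) * (2 * t\<^sup>2))) ^ (n * n)"
    if "i < n" "j < n" for i j
    by (intro lyapunov_solution_bound[OF G n sr Y(1,3)] DG t1 absG that)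
  have Yt: "\<bar>Y $$ (i, j)\<bar> \<le> t ^ (7 * N)" if "i < n" "j < n" for i j
  proof -
    have "DG\<^sup>2 * (real (n * n) * (2 * t\<^sup>2)) \<le> t\<^sup>2 * (t * (t * t\<^sup>2))"
      using DG t1 t2 nt by (intro mult_mono power_mono) auto
    also have "\<dots> = t ^ 6" by (simp add: eval_nat_numeral)
    finally have "(DG\<^sup>2 * (real (n * n) * (2 * t\<^sup>2))) ^ (n * n) \<le> (t ^ 6) ^ (n * n)"
      using DG by (intro power_mono) auto
    also have "\<dots> \<le> t ^ (6 * N)" using nnN by (simp flip: power_mult) (intro tp, simp)
    finally have "real (n * n) * (DG\<^sup>2 * (real (n * n) * (2 * t\<^sup>2))) ^ (n * n) \<le> t * t ^ (6 * N)"
      using nt t1 by (intro mult_mono) auto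
    also have "\<dots> \<le> t ^ (7 * N)" using tp[of "Suc (6 * N)" "7 * N"] N1 by simp
    finally show ?thesis using Yb[OF that] by linarith
  qed
  define lam where "lam = t ^ (8 * N)"
  have lam: "1 \<le> lam" unfolding lam_def using t1 by (rule one_le_power)
  have Yle: "v \<bullet> (Y *\<^sub>v v) \<le> lam * (v \<bullet> v)" if v: "v \<in> carrier_vec n" for v
  proof -
    have "0 \<le> v \<bullet> v" by (simp add: scalar_prod_def sum_nonneg)
    moreover have "real n * t ^ (7 * N) \<le> t * t ^ (7 * N)" using nt t1 by (intro mult_right_mono) auto
    then have "real n * t ^ (7 * N) \<le> lam"
      using tp[of "Suc (7 * N)" "8 * N"] N1 by (simp add: lam_def)
    ultimately have "real n * t ^ (7 * N) * (v \<bullet> v) \<le> lam * (v \<bullet> v)" by (intro mult_right_mono)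
    then show ?thesis using quad_form_le[OF Y(1) Yt _ v] t1 by simp
  qed

  have xt: "\<bar>x $ j\<bar> \<le> t ^ (9 * N)" if "x \<in> polyhedron_le_one ?A" "j < n" for x j
  proof -
    have "DA\<^sup>2 * (real n * (real m * t\<^sup>2)) \<le> t\<^sup>2 * (t * (t * t\<^sup>2))"
      using DA t1 nt by (intro mult_mono power_mono) auto
    also have "\<dots> = t ^ 6" by (simp add: eval_nat_numeral)
    finally have "(DA\<^sup>2 * (real n * (real m * t\<^sup>2))) ^ n \<le> (t ^ 6) ^ n"
      using DA by (intro power_mono) auto
    also have "\<dots> \<le> t ^ (6 * N)" using order_trans[OF nn nnN] by (simp flip: power_mult) (intro tp, simp)
    finally have "real n * (real m * t) * (DA\<^sup>2 * (real n * (real m * t\<^sup>2))) ^ n \<le> t * (t * t) * t ^ (6 * N)"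
      using nt t1 by (intro mult_mono) auto
    also have "\<dots> = t ^ (6 * N + 3)" by (simp add: power_add eval_nat_numeral)
    also have "\<dots> \<le> t ^ (9 * N)" using N1 by (intro tp) simp
    finally have "real n * (real m * t) * (DA\<^sup>2 * (real n * (real m * t\<^sup>2))) ^ n \<le> t ^ (9 * N)" .
    moreover have "\<bar>x $ j\<bar> \<le> real n * (real m * t) * (DA\<^sup>2 * (real n * (real m * t\<^sup>2))) ^ n"
      by (intro polyhedron_coordinate_bound[OF A m bdd that(1)] DA t1 absA that(2))
    ultimately show ?thesis by linarith
  qed
  have R: "x \<bullet> x \<le> t ^ (19 * N)" if x: "x \<in> polyhedron_le_one ?A" for x
  proof -
    have "x \<in> carrier_vec n" using x by (simp add: polyhedron_le_one_iff[OF A])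
    then have "x \<bullet> x = (\<Sum>j = 0..<n. \<bar>x $ j\<bar> * \<bar>x $ j\<bar>)" by (simp add: scalar_prod_def)
    also have "\<dots> \<le> (\<Sum>j = 0..<n. t ^ (9 * N) * t ^ (9 * N))"
      using xt[OF x] t1 by (intro sum_mono mult_mono) auto
    also have "\<dots> \<le> t * (t ^ (9 * N) * t ^ (9 * N))" using nt t1 by (simp add: mult_right_mono)
    also have "\<dots> = t ^ (18 * N + 1)" by (simp flip: power_add)
    also have "\<dots> \<le> t ^ (19 * N)" using N1 by (intro tp) simp
    finally show ?thesis .
  qed
  have s: "row ?A i \<bullet> row ?A i \<le> t ^ (3 * N)" if i: "i < m" for i
  proof -
    have "row ?A i \<bullet> row ?A i = (\<Sum>j = 0..<n. ?A $$ (i, j) * ?A $$ (i, j))"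
      using i dims by (simp add: scalar_prod_def)
    also have "\<dots> = (\<Sum>j = 0..<n. \<bar>?A $$ (i, j)\<bar> * \<bar>?A $$ (i, j)\<bar>)"
      by (simp only: abs_mult_self_eq)
    also have "\<dots> \<le> (\<Sum>j = 0..<n. t * t)"
      using absA[OF i] t1 by (intro sum_mono mult_mono) auto
    also have "\<dots> \<le> t * (t * t)" using nt t1 by (simp add: mult_right_mono)
    also have "\<dots> = t ^ 3" by (simp add: eval_nat_numeral)
    also have "\<dots> \<le> t ^ (3 * N)" using N1 by (intro tp) simp
    finally show ?thesis .
  qed
  have total: "lam\<^sup>2 * t ^ (19 * N) * t ^ (3 * N) = real (2 ^ (38 * N * N))"
  proof -
    have "lam\<^sup>2 * t ^ (19 * N) * t ^ (3 * N) = t ^ (38 * N)"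
      by (simp add: lam_def flip: power_add power_mult)
    also have "\<dots> = 2 ^ (38 * N * N)" by (simp add: t_def mult_ac flip: power_mult)
    finally show ?thesis by simp
  qed
  show ?thesis
    unfolding sufficient_step_def
  proof (intro allI impI subsetI)
    fix r :: nat and x assume r: "2 ^ (38 * N * N) \<le> r" and x: "x \<in> feasible_RLDLP ?A ?G"
    have le: "lam\<^sup>2 * t ^ (19 * N) * t ^ (3 * N) \<le> real r" unfolding total using r by (simp only: of_nat_le_iff)
    show "x \<in> fst ` feasible_SDP ?A ?G r"
      using t1
      by (intro RLDLP_feasible_imp_SDP[OF A G n sr Y lam, where R = "t ^ (19 * N)" and s = "t ^ (3 * N)"] Yle R s x le)
         simp_all
  qed
qed

definition rat_preimage :: "real mat \<Rightarrow> rat mat" where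
  "rat_preimage M = map_mat (inv_into UNIV real_of_rat) M"

lemma rat_preimage_of_rat: "rat_preimage (map_mat real_of_rat M) = M"
proof -
  have "inj (of_rat :: rat \<Rightarrow> real)" by (intro injI) simp
  then show ?thesis by (intro eq_matI) (auto simp: rat_preimage_def)
qed

text \<open>On rational data this is a function of the length of the input alone. For other data, any sufficient
  number of steps is taken.\<close>

definition step_bound :: "real mat \<Rightarrow> real mat \<Rightarrow> nat" where
  "step_bound A G = (let A' = rat_preimage A; G' = rat_preimage G; N = length (encode_data A' G') in
     if map_mat real_of_rat A' = A \<and> map_mat real_of_rat G' = G then 2 ^ (38 * N * N)
     else (SOME r0. sufficient_step A G r0))"

lemma step_bound_rational:
  "step_bound (map_mat real_of_rat A) (map_mat real_of_rat G)
    = 2 ^ (38 * length (encode_data A G) * length (encode_data A G))"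
  by (simp add: step_bound_def rat_preimage_of_rat Let_def)

lemma sufficient_step_bound:
  assumes "admissible m n A G"
  shows "sufficient_step A G (step_bound A G)"
proof (cases "map_mat real_of_rat (rat_preimage A) = A \<and> map_mat real_of_rat (rat_preimage G) = G")
  case True
  then show ?thesis
    using sufficient_step_rational[of m n "rat_preimage A" "rat_preimage G"] assms
    by (simp add: step_bound_def Let_def)
next
  case False
  then have "step_bound A G = (SOME r0. sufficient_step A G r0)" by (auto simp: step_bound_def Let_def)
  then show ?thesis using someI_ex[OF exists_sufficient_step[OF assms]] by simp
qed

lemma length_encode_data_le_data_size:
  assumes "admissible m n (map_mat real_of_rat A) (map_mat real_of_rat G)"
  shows "length (encode_data A G) \<le> 7 * data_size A G"
proof -
  have dims: "dim_col A \<ge> 1" "dim_col G \<ge> 1" "dim_row G \<ge> 1"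
    using assms by (auto simp: admissible_def)
  then have "1 \<le> dim_row G * dim_col G" by simp
  then have "1 \<le> mat_size G" unfolding mat_size_def by (rule trans_le_add2)
  then show ?thesis
    using length_encode_mat_le_mat_size[OF dims(1)] length_encode_mat_le_mat_size[OF dims(2)]
    by (simp add: encode_data_def data_size_def)
qed

text \<open>The polynomial comes from the running time, at most \<open>45 L\<^sup>2\<close> for an input of length \<open>L\<close>, with
  \<open>L \<le> 7 * data_size A G\<close> and \<open>2205 = 45 * 7\<^sup>2\<close>.\<close>

lemma step_bound_poly_time: "poly_time_on_rational_data step_bound"
  unfolding poly_time_on_rational_data_def
proof (intro exI conjI allI impI)
  show "well_formed_tm (zeros_tm 38)" by (rule well_formed_zeros_tm)
  fix m n A G assume adm: "admissible m n (map_mat real_of_rat A) (map_mat real_of_rat G)"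
  let ?w = "encode_data A G"
  define L where "L = length ?w"
  have L1: "1 \<le> L" by (simp add: L_def encode_data_def)
  have "L + L * (L * (38 + 1) + 2) + 3 \<le> 45 * L\<^sup>2"
  proof -
    have "L + L * (L * (38 + 1) + 2) + 3 = 39 * (L * L) + 3 * L + 3" by (simp add: algebra_simps)
    moreover have "L \<le> L * L" by (rule le_square)
    ultimately show ?thesis using L1 unfolding power2_eq_square by linarith
  qed
  also have "\<dots> \<le> 45 * (7 * data_size A G)\<^sup>2"
    using length_encode_data_le_data_size[OF adm] unfolding L_def by (intro mult_left_mono power_mono) auto
  also have "\<dots> = poly (monom 2205 2) (data_size A G)"
    by (simp add: poly_monom power_mult_distrib)
  finally have "computes_within (zeros_tm 38) ?w (power_word (38 * L * L)) (poly (monom 2205 2) (data_size A G))"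
    unfolding L_def by (intro zeros_tm_computes) simp_all
  then show "computes_within (zeros_tm 38) ?w
      (encode_nat (step_bound (map_mat real_of_rat A) (map_mat real_of_rat G)))
      (poly (monom 2205 2) (data_size A G))"
    unfolding step_bound_rational encode_nat_power_of_2 L_def .
qed

section \<open>Comparison of the three problems\<close>

lemma value_SDP_eq: "value_SDP c A G r = opt_value (\<lambda>x. c \<bullet> x) (fst ` feasible_SDP A G r)"
  by (simp add: value_SDP_def opt_value_lin_obj)

lemma opt_value_antimono: "F \<subseteq> F' \<Longrightarrow> opt_value f F' \<le> opt_value f F"
  unfolding opt_value_def by (rule INF_superset_mono) auto

text \<open>From this level on, the two problems minimize the same objective over the same vectors.\<close>

lemma fst_feasible_SDP_eq_RLDLP:
  assumes "admissible m n A G" "step_bound A G \<le> r"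
  shows "fst ` feasible_SDP A G r = feasible_RLDLP A G"
  using assms sufficient_step_bound[OF assms(1)] feasible_SDP_imp_RLDLP[of A m n G r]
  by (auto simp: sufficient_step_def admissible_def)

theorem theorem2p11:
  shows "\<exists>rbar :: real mat \<Rightarrow> real mat \<Rightarrow> nat.
    poly_time_on_rational_data rbar \<and>
    (\<forall>m n A G c. admissible m n A G \<and> c \<in> carrier_vec n \<longrightarrow>
      (\<forall>r. value_N c A G r = value_SDP c A G r
         \<and> fst ` optimal_N c A G r = fst ` optimal_SDP c A G r
         \<and> (\<forall>(x, H) \<in> optimal_N c A G r. \<exists>Q. mutually_inverse H Q \<and> (x, Q) \<in> optimal_SDP c A G r)
         \<and> (\<forall>(x, Q) \<in> optimal_SDP c A G r. \<exists>H. mutually_inverse H Q \<and> (x, H) \<in> optimal_N c A G r))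
      \<and> (\<forall>r. value_RLDLP c A G \<le> value_SDP c A G r)
      \<and> antimono (value_SDP c A G)
      \<and> (\<forall>r \<ge> rbar A G. value_SDP c A G r = value_RLDLP c A G
         \<and> fst ` optimal_SDP c A G r \<subseteq> optimal_RLDLP c A G))"
proof (rule exI[of _ step_bound], rule conjI, rule step_bound_poly_time, intro allI impI, elim conjE)
  fix m n A G and c :: "real vec" assume adm: "admissible m n A G" and c: "c \<in> carrier_vec n"
  have A: "A \<in> carrier_mat m n" and G: "G \<in> carrier_mat n n"
    using adm by (auto simp: admissible_def)
  note equiv = N_equivalent_SDP[OF A G]
  have bound: "value_RLDLP c A G \<le> value_SDP c A G r" for r
    unfolding value_RLDLP_def value_SDP_eq by (rule opt_value_antimono[OF feasible_SDP_imp_RLDLP[OF A G]])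
  have mono: "antimono (value_SDP c A G)"
    unfolding value_SDP_eq
    by (intro antimonoI opt_value_antimono image_mono feasible_SDP_mono[OF A G])
  have exact: "value_SDP c A G r = value_RLDLP c A G \<and> fst ` optimal_SDP c A G r \<subseteq> optimal_RLDLP c A G"
    if "step_bound A G \<le> r" for r
    using fst_feasible_SDP_eq_RLDLP[OF adm that]
    by (simp add: value_SDP_eq value_RLDLP_def optimal_SDP_def optimal_RLDLP_def fst_optimal)
  show "(\<forall>r. value_N c A G r = value_SDP c A G r
         \<and> fst ` optimal_N c A G r = fst ` optimal_SDP c A G r
         \<and> (\<forall>(x, H) \<in> optimal_N c A G r. \<exists>Q. mutually_inverse H Q \<and> (x, Q) \<in> optimal_SDP c A G r)
         \<and> (\<forall>(x, Q) \<in> optimal_SDP c A G r. \<exists>H. mutually_inverse H Q \<and> (x, H) \<in> optimal_N c A G r))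
      \<and> (\<forall>r. value_RLDLP c A G \<le> value_SDP c A G r)
      \<and> antimono (value_SDP c A G)
      \<and> (\<forall>r \<ge> step_bound A G. value_SDP c A G r = value_RLDLP c A G
         \<and> fst ` optimal_SDP c A G r \<subseteq> optimal_RLDLP c A G)"
  proof (intro conjI allI ballI impI)
    fix r
    show "value_N c A G r = value_SDP c A G r" "fst ` optimal_N c A G r = fst ` optimal_SDP c A G r"
      by (rule equiv(1), rule equiv(2))
    show "case z of (x, H) \<Rightarrow> \<exists>Q. mutually_inverse H Q \<and> (x, Q) \<in> optimal_SDP c A G r"
      if "z \<in> optimal_N c A G r" for z
      using that equiv(3)[of "fst z" "snd z"] by (simp add: case_prod_unfold)
    show "case z of (x, Q) \<Rightarrow> \<exists>H. mutually_inverse H Q \<and> (x, H) \<in> optimal_N c A G r"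
      if "z \<in> optimal_SDP c A G r" for z
      using that equiv(4)[of "fst z" "snd z"] by (simp add: case_prod_unfold)
    show "value_RLDLP c A G \<le> value_SDP c A G r" by (rule bound)
    show "antimono (value_SDP c A G)" by (rule mono)
    assume "step_bound A G \<le> r"
    then show "value_SDP c A G r = value_RLDLP c A G" "fst ` optimal_SDP c A G r \<subseteq> optimal_RLDLP c A G"
      using exact by blast+
  qed
qed

end
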